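(* Let $p$ be an integer which is either an odd prime or composite. Let $L$ be a non-split link which admits non-trivial $p$-colorings. 1. If there is a diagram of $L$ which admits a non-trivial $p$-coloring using the least number of colors, $\mathrm{mincol}_p L$, and featuring a crossing at which the over-arc has color $1$ and the two under-arcs have colors $0$ and $2$ (mod $p$), then $\mathrm{maxcol}_p L = p$. 2. If there is a diagram of $L$ which admits a non-trivial $p$-coloring using the least number of colors, $\mathrm{mincol}_p L$, and featuring a crossing at which the over-arc has color $b$ and the two under-arcs have colors $a$ and $2b-a$ (mod $p$), with $b-a$ invertible mod $p$, then $\mathrm{maxcol}_p L = p$.
   Context: Links are classical links in $3$-space. A split link is a link which can be made (by isotopy) to be contained in two disjoint balls in $3$-space, with part of the link in each ball; a non-split link is a link which is not split. For an integer $p>1$ and a diagram $D$ of a link $L$, a $p$-coloring of $D$ is an assignment of integers modulo $p$ (called colors) to the arcs of $D$ such that at each crossing, twice the color of the over-arc equals the sum of the colors of the two under-arcs, modulo $p$. A $p$-coloring is trivial if all arcs of the diagram receive the same color, and non-trivial if it uses more than one color. Whether a link admits non-trivial $p$-colorings does not depend on the diagram. Suppose $L$ admits non-trivial $p$-colorings. $\mathrm{mincol}_p L$ is the minimum number of distinct colors used in a non-trivial $p$-coloring of a diagram of $L$, taken over all diagrams of $L$ and all their non-trivial $p$-colorings; $\mathrm{maxcol}_p L$ is the maximum number of distinct colors used in a non-trivial $p$-coloring of a diagram of $L$, taken over all diagrams of $L$ and all their non-trivial $p$-colorings. *)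

theory Defs
  imports "HOL-Analysis.Analysis" "HOL-Number_Theory.Cong"
begin

text \<open>
  The type splits 3-space into the plane of projection and the height: \<open>fst\<close> is the projection
  along which diagrams are drawn and \<open>snd\<close> decides what is over and what is under. The product
  norm is the Euclidean one, so \<open>cball\<close> is a round ball.
\<close>

type_synonym space3 = "(real \<times> real) \<times> real"


section \<open>Links and isotopy\<close>

definition polygonal_knot :: "space3 set \<Rightarrow> bool" where
  "polygonal_knot K \<longleftrightarrow>
     (\<exists>g. simple_path g \<and> pathfinish g = pathstart g \<and> path_image g = K) \<and>
     (\<exists>S. finite S \<and> K = (\<Union>(a, b)\<in>S. closed_segment a b))"

definition polygonal_link :: "space3 set \<Rightarrow> bool" where
  "polygonal_link L \<longleftrightarrow>
     (\<exists>C. finite C \<and> C \<noteq> {} \<and> pairwise disjnt C \<and> (\<forall>K\<in>C. polygonal_knot K) \<and> L = \<Union>C)"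

text \<open>The property imposed on every stage makes the homotopy from the identity an isotopy of
  the whole space.\<close>

definition ambient_isotopic :: "space3 set \<Rightarrow> space3 set \<Rightarrow> bool" where
  "ambient_isotopic L M \<longleftrightarrow>
     (\<exists>f. homotopic_with_canon (\<lambda>h. \<exists>k. homeomorphism UNIV UNIV h k) UNIV UNIV id f \<and> f ` L = M)"

text \<open>Classical links are the tame ones; smooth links are included.\<close>

definition classical_link :: "space3 set \<Rightarrow> bool" where
  "classical_link L \<longleftrightarrow> (\<exists>P. polygonal_link P \<and> ambient_isotopic P L)"

definition split_link :: "space3 set \<Rightarrow> bool" where
  "split_link L \<longleftrightarrow>
     (\<exists>M x r y s. ambient_isotopic L M \<and> cball x r \<inter> cball y s = {} \<and>
        M \<subseteq> cball x r \<union> cball y s \<and> M \<inter> cball x r \<noteq> {} \<and> M \<inter> cball y s \<noteq> {})"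


section \<open>Diagrams\<close>

definition straight_at :: "space3 set \<Rightarrow> space3 \<Rightarrow> bool" where
  "straight_at D x \<longleftrightarrow>
     (\<exists>y e. y \<noteq> x \<and> e > 0 \<and> D \<inter> ball x e = affine hull {x, y} \<inter> ball x e)"

definition multiple_points :: "space3 set \<Rightarrow> space3 set" where
  "multiple_points D = {x \<in> D. \<exists>y\<in>D. y \<noteq> x \<and> fst y = fst x}"

text \<open>
  Finitely many multiple points, all of them double, and no vertex of the polygon among them.
  The two strands at a double point then cross transversally in the plane, since two strands
  with parallel projections would yield infinitely many multiple points.
\<close>

definition regular_projection :: "space3 set \<Rightarrow> bool" where
  "regular_projection D \<longleftrightarrow>
     finite (multiple_points D) \<and>
     (\<forall>x\<in>D. \<forall>y\<in>D. \<forall>z\<in>D. fst x = fst y \<and> fst y = fst z \<longrightarrow> x = y \<or> y = z \<or> x = z) \<and>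
     (\<forall>x\<in>multiple_points D. straight_at D x)"

text \<open>
  A diagram is represented by a polygonal link in regular position: its image under \<open>fst\<close> is the
  planar picture, and the heights provide the over/under information.
\<close>

definition diagram_of :: "space3 set \<Rightarrow> space3 set \<Rightarrow> bool" where
  "diagram_of D L \<longleftrightarrow> polygonal_link D \<and> regular_projection D \<and> ambient_isotopic D L"

definition undercrossing :: "space3 set \<Rightarrow> space3 \<Rightarrow> space3 \<Rightarrow> bool" where
  "undercrossing D u v \<longleftrightarrow> u \<in> D \<and> v \<in> D \<and> fst u = fst v \<and> snd u < snd v"

text \<open>Cutting at the undercrossings gives the arcs. A component of the link that never passes
  under contributes one closed arc.\<close>

definition arcs :: "space3 set \<Rightarrow> space3 set set" where
  "arcs D = components (D - {u. \<exists>v. undercrossing D u v})"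

text \<open>
  \<open>B\<close> and \<open>C\<close> are the under-arcs, in either order: the arcs ending at the undercrossing are
  those having it in their closure. They coincide if one arc has both its ends there, as in
  the two-crossing diagram of the Hopf link.
\<close>

definition crossing :: "space3 set \<Rightarrow> space3 set \<Rightarrow> space3 set \<Rightarrow> space3 set \<Rightarrow> bool" where
  "crossing D A B C \<longleftrightarrow>
     (\<exists>u v. undercrossing D u v \<and> A \<in> arcs D \<and> v \<in> A \<and> {X \<in> arcs D. u \<in> closure X} = {B, C})"


section \<open>Colorings\<close>

text \<open>Colors are the representatives \<open>0, \<dots>, p - 1\<close> of the residue classes, so that distinct
  colors are distinct numbers. Values outside \<open>arcs D\<close> are irrelevant.\<close>

definition coloring :: "nat \<Rightarrow> space3 set \<Rightarrow> (space3 set \<Rightarrow> int) \<Rightarrow> bool" where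
  "coloring p D c \<longleftrightarrow>
     (\<forall>A\<in>arcs D. c A \<in> {0..<int p}) \<and>
     (\<forall>A B C. crossing D A B C \<longrightarrow> [2 * c A = c B + c C] (mod int p))"

definition num_colors :: "space3 set \<Rightarrow> (space3 set \<Rightarrow> int) \<Rightarrow> nat" where
  "num_colors D c = card (c ` arcs D)"

definition nontrivial_coloring :: "nat \<Rightarrow> space3 set \<Rightarrow> (space3 set \<Rightarrow> int) \<Rightarrow> bool" where
  "nontrivial_coloring p D c \<longleftrightarrow> coloring p D c \<and> num_colors D c > 1"

definition admits_nontrivial_colorings :: "nat \<Rightarrow> space3 set \<Rightarrow> bool" where
  "admits_nontrivial_colorings p L \<longleftrightarrow> (\<exists>D c. diagram_of D L \<and> nontrivial_coloring p D c)"

definition color_counts :: "nat \<Rightarrow> space3 set \<Rightarrow> nat set" where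
  "color_counts p L = {num_colors D c | D c. diagram_of D L \<and> nontrivial_coloring p D c}"

definition mincol :: "nat \<Rightarrow> space3 set \<Rightarrow> nat" where
  "mincol p L = Min (color_counts p L)"

definition maxcol :: "nat \<Rightarrow> space3 set \<Rightarrow> nat" where
  "maxcol p L = Max (color_counts p L)"

text \<open>Hence \<open>mincol\<close> and \<open>maxcol\<close> are a genuine minimum and maximum as soon as the link admits
  non-trivial colorings.\<close>

lemma color_counts_subset: "color_counts p L \<subseteq> {2..p}"
proof
  fix n assume "n \<in> color_counts p L"
  then obtain D c where n: "n = num_colors D c" and c: "nontrivial_coloring p D c"
    unfolding color_counts_def by blast
  have "c ` arcs D \<subseteq> {0..<int p}"
    using c unfolding nontrivial_coloring_def coloring_def by blast
  then have "card (c ` arcs D) \<le> card {0..<int p}"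
    by (intro card_mono) auto
  with n c show "n \<in> {2..p}"
    unfolding nontrivial_coloring_def num_colors_def by simp
qed

lemma finite_color_counts: "finite (color_counts p L)"
  using color_counts_subset finite_atLeastAtMost finite_subset by metis

end

theory Submission
  imports Defs
begin

text \<open>
  All \<open>p\<close> colors can be created by local moves near the given crossing. Suppose that a strand of
  color \<open>b\<close> passes over a strand whose color changes there from \<open>a\<close> to \<open>2 * b - a\<close>. Push a finger of
  the over-strand underneath the half of the lower strand that has color \<open>2 * b - a\<close> (a
  Reidemeister move of the second kind). All colors survive, except that the tip of the finger
  must be given the color \<open>2 * (2 * b - a) - b = 3 * b - 2 * a\<close>. At the two new crossings the
  over-arc has color \<open>2 * b - a\<close>, and the under-arcs have the colors \<open>b\<close> and \<open>3 * b - 2 * a\<close>. This is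
  a crossing of the original kind, with \<open>(a, b)\<close> replaced by \<open>(b, 2 * b - a)\<close> and with the same
  difference \<open>b - a\<close>. Iterating the move produces the colors \<open>a + j * (b - a)\<close> for
  \<open>j = 0, \<dots>, p\<close>, which are all residues when \<open>b - a\<close> is a unit. The move is \<open>coloring_step\<close>, the
  iteration \<open>coloring_progression\<close>, the conclusion \<open>maxcol_eq_of_unit_crossing\<close>.

  The finger move is carried out by one explicit homeomorphism \<open>push\<close> of 3-space,
  \<open>p \<mapsto> p + bump p *\<^sub>R e\<close> for a fixed vector \<open>e\<close>. It is isotopic to the identity by scaling \<open>bump\<close>,
  because \<open>bump\<close> is \<open>1/2\<close>-Lipschitz along \<open>e\<close> (\<open>shear_homeomorphism\<close>, \<open>ambient_isotopic_shear\<close>).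
  It maps polygons to polygons because \<open>bump\<close> is piecewise affine (\<open>polygonal_link_image\<close>). By
  compactness a diagram consists of just two straight strands over a neighborhood of a crossing,
  so a linear chart brings it into the standard form of the locale \<open>crossing_chart\<close>, in which \<open>push\<close>
  is written down and the new multiple points are computed.

  Arcs are awkward to follow through this move, since cutting an arc at two points leaves one or
  two pieces besides the middle one, depending on whether it is closed. Colorings are
  therefore treated as functions of the points of the diagram that are constant on connected sets avoiding the undercrossings (\<open>point_coloring\<close>); \<open>point_coloring_color_at\<close> and
  \<open>coloring_of_point_coloring\<close> translate between the two descriptions.
\<close>

section \<open>Isotopies of space\<close>

text \<open>Precomposing the second isotopy with the final homeomorphism \<open>f\<close> of the first one makes it
  start where the first one ends.\<close>

lemma ambient_isotopic_trans:
  assumes "ambient_isotopic L M" "ambient_isotopic M N"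
  shows "ambient_isotopic L N"
proof -
  let ?P = "\<lambda>h :: space3 \<Rightarrow> space3. \<exists>k. homeomorphism UNIV UNIV h k"
  obtain f g where f: "homotopic_with_canon ?P UNIV UNIV id f" "f ` L = M"
    and g: "homotopic_with_canon ?P UNIV UNIV id g" "g ` M = N"
    using assms unfolding ambient_isotopic_def by metis
  have Pf: "?P f"
    using homotopic_with_imp_property[OF f(1)] by simp
  then obtain k where k: "homeomorphism UNIV UNIV f k" by blast
  have "homotopic_with_canon (\<lambda>h. ?P (h \<circ> f)) UNIV UNIV id g"
    by (rule homotopic_with_mono[OF g(1)]) (metis k homeomorphism_compose)
  then have "homotopic_with_canon ?P UNIV UNIV (id \<circ> f) (g \<circ> f)"
    by (rule homotopic_with_compose_continuous_right)
      (use k homeomorphism_cont1 in auto)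
  then have "homotopic_with_canon ?P UNIV UNIV id (g \<circ> f)"
    using homotopic_with_trans[OF f(1)] by simp
  moreover have "(g \<circ> f) ` L = N"
    using f g by (metis image_comp)
  ultimately show ?thesis
    unfolding ambient_isotopic_def by blast
qed

text \<open>Precomposing the isotopy from \<open>id\<close> to \<open>f\<close> with the inverse \<open>k\<close> of \<open>f\<close> turns it into one from \<open>k\<close>
  to \<open>id\<close>. Inverting every stage instead would require the inverses to depend continuously on
  the stage.\<close>

lemma ambient_isotopic_sym:
  assumes "ambient_isotopic L M"
  shows "ambient_isotopic M L"
proof -
  let ?P = "\<lambda>h :: space3 \<Rightarrow> space3. \<exists>k. homeomorphism UNIV UNIV h k"
  obtain f where f: "homotopic_with_canon ?P UNIV UNIV id f" "f ` L = M"
    using assms unfolding ambient_isotopic_def by blast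
  have "?P f"
    using homotopic_with_imp_property[OF f(1)] by simp
  then obtain k where k: "homeomorphism UNIV UNIV f k" by blast
  then have k': "homeomorphism UNIV UNIV k f"
    by (rule homeomorphism_symD)
  have kf: "f \<circ> k = id" "k \<circ> f = id"
    using homeomorphism_apply2[OF k] homeomorphism_apply1[OF k] by (simp_all add: fun_eq_iff)
  have "homotopic_with_canon (\<lambda>h. ?P (h \<circ> k)) UNIV UNIV id f"
    by (rule homotopic_with_mono[OF f(1)]) (metis k' homeomorphism_compose)
  then have "homotopic_with_canon ?P UNIV UNIV (id \<circ> k) (f \<circ> k)"
    by (rule homotopic_with_compose_continuous_right)
      (use k' homeomorphism_cont1 in auto)
  then have "homotopic_with_canon ?P UNIV UNIV id k"
    using kf homotopic_with_symD by auto
  moreover have "k ` M = L"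
    using f(2) kf(2) by (metis image_comp image_id id_apply)
  ultimately show ?thesis
    unfolding ambient_isotopic_def by blast
qed

text \<open>On every line in direction \<open>e\<close> the map is \<open>s \<mapsto> s + g\<close> with \<open>g\<close> a contraction: hence it is
  injective there, and surjective because a preimage is a fixed point of a contraction. Invariance
  of domain makes the inverse continuous.\<close>

lemma shear_homeomorphism:
  fixes g :: "'a::euclidean_space \<Rightarrow> real" and e :: 'a
  assumes cont: "continuous_on UNIV g"
    and lip: "\<And>p s. \<bar>g (p + s *\<^sub>R e) - g p\<bar> \<le> \<bar>s\<bar> / 2"
  shows "\<exists>k. homeomorphism UNIV UNIV (\<lambda>p. p + g p *\<^sub>R e) k"
proof -
  let ?h = "\<lambda>p. p + g p *\<^sub>R e"
  have inj: "inj ?h"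
  proof (rule injI)
    fix p q assume eq: "?h p = ?h q"
    define s where "s = g p - g q"
    have q: "q = p + s *\<^sub>R e"
      using eq unfolding s_def by (simp add: algebra_simps)
    have gq: "g q - g p = - s" by (simp add: s_def)
    have "\<bar>s\<bar> \<le> \<bar>s\<bar> / 2"
      using lip[of p s] unfolding q[symmetric] gq by simp
    then show "p = q" using q by simp
  qed
  have "q \<in> range ?h" for q
  proof -
    have "\<exists>!s. - g (q + s *\<^sub>R e) = s"
    proof (rule banach_fix_type[where c = "1/2"])
      show "\<forall>s t. dist (- g (q + s *\<^sub>R e)) (- g (q + t *\<^sub>R e)) \<le> 1 / 2 * dist s t"
      proof (intro allI)
        fix s t
        show "dist (- g (q + s *\<^sub>R e)) (- g (q + t *\<^sub>R e)) \<le> 1 / 2 * dist s t"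
          using lip[of "q + s *\<^sub>R e" "t - s"]
          by (simp add: dist_real_def algebra_simps abs_minus_commute)
      qed
    qed auto
    then obtain s where "- g (q + s *\<^sub>R e) = s" by (rule ex1E)
    then have g: "g (q + s *\<^sub>R e) = - s" by linarith
    have "q = ?h (q + s *\<^sub>R e)" by (simp add: g)
    then show ?thesis by (rule range_eqI)
  qed
  then have surj: "range ?h = UNIV" by blast
  have "continuous_on UNIV ?h"
    by (intro continuous_intros cont)
  then obtain k where "homeomorphism UNIV (range ?h) ?h k"
    using invariance_of_domain_homeomorphism[OF open_UNIV _ _ inj] by auto
  then show ?thesis using surj by auto
qed

text \<open>The stages of the isotopy are the shears with \<open>t * g\<close> in place of \<open>g\<close>, for \<open>t\<close> from \<open>0\<close> to \<open>1\<close>.\<close>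

lemma ambient_isotopic_shear:
  fixes g :: "space3 \<Rightarrow> real" and e :: space3
  assumes cont: "continuous_on UNIV g"
    and lip: "\<And>p s. \<bar>g (p + s *\<^sub>R e) - g p\<bar> \<le> \<bar>s\<bar> / 2"
  shows "ambient_isotopic D ((\<lambda>p. p + g p *\<^sub>R e) ` D)"
proof -
  let ?P = "\<lambda>h :: space3 \<Rightarrow> space3. \<exists>k. homeomorphism UNIV UNIV h k"
  let ?H = "\<lambda>(t, p). p + (t * g p) *\<^sub>R e"
  have P: "?P (\<lambda>p. p + (t * g p) *\<^sub>R e)" if "t \<in> {0..1}" for t :: real
  proof (rule shear_homeomorphism)
    show "continuous_on UNIV (\<lambda>p. t * g p)"
      by (intro continuous_intros cont)
    fix p s
    have "\<bar>t * g (p + s *\<^sub>R e) - t * g p\<bar> = t * \<bar>g (p + s *\<^sub>R e) - g p\<bar>"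
      using that by (simp add: abs_mult flip: right_diff_distrib)
    also have "\<dots> \<le> 1 * (\<bar>s\<bar> / 2)"
      using that lip by (intro mult_mono) auto
    finally show "\<bar>t * g (p + s *\<^sub>R e) - t * g p\<bar> \<le> \<bar>s\<bar> / 2" by simp
  qed
  have g': "continuous_on ({0..1} \<times> UNIV) (\<lambda>x. g (snd x))"
    by (rule continuous_on_compose2[OF cont]) (auto intro: continuous_intros)
  have top: "prod_topology (top_of_set {0..1::real}) (top_of_set (UNIV :: space3 set))
      = top_of_set ({0..1} \<times> UNIV)"
    by (metis subtopology_Times prod_topology_euclidean)
  have "homotopic_with_canon ?P UNIV UNIV id (\<lambda>p. p + g p *\<^sub>R e)"
    unfolding homotopic_with_def
  proof (intro exI[of _ ?H] conjI allI ballI)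
    show "continuous_map (prod_topology (top_of_set {0..1}) (top_of_set UNIV)) (top_of_set UNIV) ?H"
      unfolding top case_prod_unfold continuous_map_subtopology_eu
      by (auto intro!: continuous_intros g')
    show "?P (\<lambda>p. ?H (t, p))" if "t \<in> {0..1}" for t
      using P[OF that] by simp
  qed auto
  then show ?thesis
    unfolding ambient_isotopic_def by blast
qed


section \<open>Piecewise affine maps and polygons\<close>

text \<open>The interpolation formula is demanded on the segment only, so that a map such as the absolute
  value can be affine on each piece of a subdivision.\<close>

definition affine_on_segment :: "('a::real_vector \<Rightarrow> 'b::real_vector) \<Rightarrow> 'a \<Rightarrow> 'a \<Rightarrow> bool" where
  "affine_on_segment f a b \<longleftrightarrow>
     (\<forall>t\<in>{0..1}. f ((1 - t) *\<^sub>R a + t *\<^sub>R b) = (1 - t) *\<^sub>R f a + t *\<^sub>R f b)"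

definition piecewise_affine :: "('a::real_vector \<Rightarrow> 'b::real_vector) \<Rightarrow> bool" where
  "piecewise_affine f \<longleftrightarrow>
     (\<forall>a b. \<exists>S. finite S \<and> closed_segment a b = (\<Union>(c, d)\<in>S. closed_segment c d) \<and>
        (\<forall>(c, d)\<in>S. affine_on_segment f c d))"

lemma piecewise_affineE:
  assumes "piecewise_affine f"
  obtains S where "finite S" "closed_segment a b = (\<Union>(c, d)\<in>S. closed_segment c d)"
    "\<forall>(c, d)\<in>S. affine_on_segment f c d"
proof -
  have "\<exists>S. finite S \<and> closed_segment a b = (\<Union>(c, d)\<in>S. closed_segment c d) \<and>
      (\<forall>(c, d)\<in>S. affine_on_segment f c d)"
    by (rule assms[unfolded piecewise_affine_def, THEN spec, THEN spec])
  then obtain S where "finite S" "closed_segment a b = (\<Union>(c, d)\<in>S. closed_segment c d)"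
    "\<forall>(c, d)\<in>S. affine_on_segment f c d"
    by (elim exE conjE)
  then show thesis by (intro that[of S]) auto
qed

lemma affine_on_segment_image:
  assumes "affine_on_segment f a b"
  shows "f ` closed_segment a b = closed_segment (f a) (f b)"
  using assms unfolding affine_on_segment_def closed_segment_def by (force simp: image_iff)

lemma affine_on_segment_subset:
  assumes f: "affine_on_segment f a b"
    and c: "c \<in> closed_segment a b" and d: "d \<in> closed_segment a b"
  shows "affine_on_segment f c d"
proof -
  obtain r s where r: "0 \<le> r" "r \<le> 1" "c = (1 - r) *\<^sub>R a + r *\<^sub>R b"
    and s: "0 \<le> s" "s \<le> 1" "d = (1 - s) *\<^sub>R a + s *\<^sub>R b"
    using c d unfolding closed_segment_def by auto
  show ?thesis
    unfolding affine_on_segment_def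
  proof
    fix t :: real assume t: "t \<in> {0..1}"
    define q where "q = (1 - t) * r + t * s"
    have q: "q \<in> {0..1}"
      using r s t convex_bound_le[of r 1 s "1 - t" t] unfolding q_def by simp
    have *: "(1 - t) *\<^sub>R ((1 - r) *\<^sub>R x + r *\<^sub>R y) + t *\<^sub>R ((1 - s) *\<^sub>R x + s *\<^sub>R y)
        = (1 - q) *\<^sub>R x + q *\<^sub>R y" for x y :: "'z::real_vector"
      unfolding q_def by (simp add: algebra_simps)
    have fr: "f c = (1 - r) *\<^sub>R f a + r *\<^sub>R f b" and fs: "f d = (1 - s) *\<^sub>R f a + s *\<^sub>R f b"
      using f r s unfolding affine_on_segment_def by auto
    have "f ((1 - t) *\<^sub>R c + t *\<^sub>R d) = f ((1 - q) *\<^sub>R a + q *\<^sub>R b)"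
      unfolding r s * ..
    also have "\<dots> = (1 - q) *\<^sub>R f a + q *\<^sub>R f b"
      using f q unfolding affine_on_segment_def by blast
    also have "\<dots> = (1 - t) *\<^sub>R f c + t *\<^sub>R f d"
      unfolding fr fs * ..
    finally show "f ((1 - t) *\<^sub>R c + t *\<^sub>R d) = (1 - t) *\<^sub>R f c + t *\<^sub>R f d" .
  qed
qed

text \<open>Combines subdivisions of the individual pieces into one subdivision of the whole; \<open>F a b\<close> is the
  segment from \<open>a\<close> to \<open>b\<close> itself or its image under a map.\<close>

lemma finite_segment_unionI:
  assumes "finite S"
    and "\<And>a b. (a, b) \<in> S \<Longrightarrow> \<exists>T. finite T \<and> F a b = (\<Union>(c, d)\<in>T. closed_segment c d) \<and> (\<forall>(c, d)\<in>T. P c d)"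
  shows "\<exists>T. finite T \<and> (\<Union>(a, b)\<in>S. F a b) = (\<Union>(c, d)\<in>T. closed_segment c d) \<and> (\<forall>(c, d)\<in>T. P c d)"
proof -
  have "\<forall>x\<in>S. \<exists>T. finite T \<and> F (fst x) (snd x) = (\<Union>(c, d)\<in>T. closed_segment c d) \<and> (\<forall>(c, d)\<in>T. P c d)"
    using assms(2) by (metis prod.collapse)
  then obtain T where T: "\<forall>x\<in>S. finite (T x) \<and>
      F (fst x) (snd x) = (\<Union>(c, d)\<in>T x. closed_segment c d) \<and> (\<forall>(c, d)\<in>T x. P c d)"
    by (auto dest!: bchoice)
  show ?thesis
  proof (intro exI[of _ "\<Union>x\<in>S. T x"] conjI)
    show "finite (\<Union>x\<in>S. T x)" using assms(1) T by blast
    have "(\<Union>(a, b)\<in>S. F a b) = (\<Union>x\<in>S. (\<Union>(c, d)\<in>T x. closed_segment c d))"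
      using T by (auto simp: case_prod_unfold)
    then show "(\<Union>(a, b)\<in>S. F a b) = (\<Union>(c, d)\<in>(\<Union>x\<in>S. T x). closed_segment c d)"
      by simp
    show "\<forall>(c, d)\<in>(\<Union>x\<in>S. T x). P c d" using T by blast
  qed
qed

lemma piecewise_affine_add:
  assumes f: "piecewise_affine f" and g: "piecewise_affine g"
  shows "piecewise_affine (\<lambda>x. f x + g x)"
  unfolding piecewise_affine_def
proof (intro allI)
  fix a b
  obtain S where S: "finite S" "closed_segment a b = (\<Union>(c, d)\<in>S. closed_segment c d)"
    "\<forall>(c, d)\<in>S. affine_on_segment f c d"
    by (rule piecewise_affineE[where a=a and b=b, OF f])
  have S3: "\<And>c d. (c, d) \<in> S \<Longrightarrow> affine_on_segment f c d"
    using S(3) by auto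
  show "\<exists>T. finite T \<and> closed_segment a b = (\<Union>(c, d)\<in>T. closed_segment c d) \<and>
        (\<forall>(c, d)\<in>T. affine_on_segment (\<lambda>x. f x + g x) c d)"
    unfolding S(2)
  proof (rule finite_segment_unionI[OF S(1)])
    fix c d assume cd: "(c, d) \<in> S"
    obtain T where T: "finite T" "closed_segment c d = (\<Union>(a, b)\<in>T. closed_segment a b)"
      "\<forall>(a, b)\<in>T. affine_on_segment g a b"
      by (rule piecewise_affineE[where a=c and b=d, OF g])
    have T3: "\<And>a b. (a, b) \<in> T \<Longrightarrow> affine_on_segment g a b"
      using T(3) by auto
    have "affine_on_segment (\<lambda>x. f x + g x) a b" if "(a, b) \<in> T" for a b
    proof -
      have "a \<in> closed_segment c d" "b \<in> closed_segment c d"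
        unfolding T(2) using that by force+
      then have "affine_on_segment f a b"
        using affine_on_segment_subset S3[OF cd] by blast
      then show ?thesis
        using T3[OF that] unfolding affine_on_segment_def by (simp add: scaleR_add_right)
    qed
    then show "\<exists>T. finite T \<and> closed_segment c d = (\<Union>(c, d)\<in>T. closed_segment c d) \<and>
        (\<forall>(c, d)\<in>T. affine_on_segment (\<lambda>x. f x + g x) c d)"
      using T(1,2) by (intro exI[of _ T]) auto
  qed
qed

lemma piecewise_affine_scaleR:
  fixes v :: "'b::real_vector"
  assumes "piecewise_affine f"
  shows "piecewise_affine (\<lambda>x. f x *\<^sub>R v)"
proof -
  have "affine_on_segment (\<lambda>x. f x *\<^sub>R v) c d" if "affine_on_segment f c d" for c d
    using that unfolding affine_on_segment_def by (simp add: scaleR_add_left)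
  note scaled = this
  show ?thesis
    unfolding piecewise_affine_def
  proof (intro allI)
    fix a b
    obtain S where S: "finite S" "closed_segment a b = (\<Union>(c, d)\<in>S. closed_segment c d)"
      "\<forall>(c, d)\<in>S. affine_on_segment f c d"
      by (rule piecewise_affineE[where a=a and b=b, OF assms])
    have S3: "\<And>c d. (c, d) \<in> S \<Longrightarrow> affine_on_segment f c d"
      using S(3) by auto
    show "\<exists>S. finite S \<and> closed_segment a b = (\<Union>(c, d)\<in>S. closed_segment c d) \<and>
        (\<forall>(c, d)\<in>S. affine_on_segment (\<lambda>x. f x *\<^sub>R v) c d)"
      using S(1,2) S3 scaled by (intro exI[of _ S]) auto
  qed
qed

text \<open>A piece on which \<open>f\<close> changes sign is cut at its zero. Together with sums and multiples this covers
  maxima, as \<open>max 0 r = (r + \<bar>r\<bar>) / 2\<close>.\<close>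

lemma piecewise_affine_abs:
  fixes f :: "'a::euclidean_space \<Rightarrow> real"
  assumes f: "piecewise_affine f"
  shows "piecewise_affine (\<lambda>x. \<bar>f x\<bar>)"
  unfolding piecewise_affine_def
proof (intro allI)
  fix a b
  obtain S where S: "finite S" "closed_segment a b = (\<Union>(c, d)\<in>S. closed_segment c d)"
    "\<forall>(c, d)\<in>S. affine_on_segment f c d"
    by (rule piecewise_affineE[where a=a and b=b, OF f])
  have S3: "\<And>c d. (c, d) \<in> S \<Longrightarrow> affine_on_segment f c d"
    using S(3) by auto
  have same: "affine_on_segment (\<lambda>x. \<bar>f x\<bar>) c d"
    if fcd: "affine_on_segment f c d" and sgn: "0 \<le> f c * f d" for c d
  proof -
    have "\<bar>(1 - t) * f c + t * f d\<bar> = (1 - t) * \<bar>f c\<bar> + t * \<bar>f d\<bar>" if "t \<in> {0..1}" for t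
    proof -
      have "0 \<le> f c \<and> 0 \<le> f d \<or> f c \<le> 0 \<and> f d \<le> 0"
        using sgn by (auto simp: zero_le_mult_iff)
      then show ?thesis
      proof
        assume "0 \<le> f c \<and> 0 \<le> f d"
        then show ?thesis using that by simp
      next
        assume *: "f c \<le> 0 \<and> f d \<le> 0"
        then have "(1 - t) * f c + t * f d \<le> 0"
          using that by (intro add_nonpos_nonpos mult_nonneg_nonpos) auto
        then show ?thesis using * by simp
      qed
    qed
    then show ?thesis
      using fcd unfolding affine_on_segment_def by simp
  qed
  show "\<exists>T. finite T \<and> closed_segment a b = (\<Union>(c, d)\<in>T. closed_segment c d) \<and>
        (\<forall>(c, d)\<in>T. affine_on_segment (\<lambda>x. \<bar>f x\<bar>) c d)"
    unfolding S(2)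
  proof (rule finite_segment_unionI[OF S(1)])
    fix c d assume cd: "(c, d) \<in> S"
    show "\<exists>T. finite T \<and> closed_segment c d = (\<Union>(c, d)\<in>T. closed_segment c d) \<and>
        (\<forall>(c, d)\<in>T. affine_on_segment (\<lambda>x. \<bar>f x\<bar>) c d)"
    proof (cases "0 \<le> f c * f d")
      case True
      then show ?thesis
        using same[OF S3[OF cd]] by (intro exI[of _ "{(c, d)}"]) simp
    next
      case False
      then have ne: "f c \<noteq> f d" by (metis zero_le_square)
      define t where "t = f c / (f c - f d)"
      define z where "z = (1 - t) *\<^sub>R c + t *\<^sub>R d"
      have t: "t \<in> {0..1}"
        using False unfolding t_def by (auto simp: zero_le_mult_iff field_simps divide_simps)
      then have z: "z \<in> closed_segment c d"
        unfolding z_def closed_segment_def by auto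
      have "f z = (1 - t) * f c + t * f d"
        using S3[OF cd] t unfolding z_def affine_on_segment_def by simp
      also have "\<dots> = 0"
        using ne unfolding t_def by (simp add: field_simps)
      finally have fz: "f z = 0" .
      have "affine_on_segment f c z" "affine_on_segment f z d"
        using affine_on_segment_subset[OF S3[OF cd]] z by auto
      then have "affine_on_segment (\<lambda>x. \<bar>f x\<bar>) c z" "affine_on_segment (\<lambda>x. \<bar>f x\<bar>) z d"
        using same fz by auto
      then show ?thesis
        using Un_closed_segment[OF z] by (intro exI[of _ "{(c, z), (z, d)}"]) auto
    qed
  qed
qed

lemma piecewise_affine_affine:
  assumes "\<And>a b. affine_on_segment f a b"
  shows "piecewise_affine f"
  unfolding piecewise_affine_def
proof (intro allI)
  fix a b
  show "\<exists>S. finite S \<and> closed_segment a b = (\<Union>(c, d)\<in>S. closed_segment c d) \<and>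
        (\<forall>(c, d)\<in>S. affine_on_segment f c d)"
    using assms by (intro exI[of _ "{(a, b)}"]) simp
qed

lemma polygonal_link_image:
  fixes h :: "space3 \<Rightarrow> space3"
  assumes L: "polygonal_link L"
    and pa: "piecewise_affine h" and inj: "inj h" and cont: "continuous_on UNIV h"
  shows "polygonal_link (h ` L)"
proof -
  obtain C where C: "finite C" "C \<noteq> {}" "pairwise disjnt C" "\<And>K. K \<in> C \<Longrightarrow> polygonal_knot K" "L = \<Union>C"
    using L unfolding polygonal_link_def by blast
  have knot: "polygonal_knot (h ` K)" if K: "polygonal_knot K" for K
    unfolding polygonal_knot_def
  proof
    obtain g where g: "simple_path g" "pathfinish g = pathstart g" "path_image g = K"
      using K unfolding polygonal_knot_def by blast
    have "simple_path (h \<circ> g)"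
      using g cont inj by (intro simple_path_continuous_image) (auto intro: continuous_on_subset inj_on_subset)
    then show "\<exists>g. simple_path g \<and> pathfinish g = pathstart g \<and> path_image g = h ` K"
      using g by (intro exI[of _ "h \<circ> g"]) (auto simp: path_image_compose pathfinish_compose pathstart_compose)
    obtain S where S: "finite S" "K = (\<Union>(a, b)\<in>S. closed_segment a b)"
      using K unfolding polygonal_knot_def by blast
    have "\<exists>T. finite T \<and> (\<Union>(a, b)\<in>S. h ` closed_segment a b) = (\<Union>(c, d)\<in>T. closed_segment c d) \<and>
        (\<forall>(c, d)\<in>T. True)"
    proof (rule finite_segment_unionI[OF S(1)])
      fix a b
      obtain T where T: "finite T" "closed_segment a b = (\<Union>(c, d)\<in>T. closed_segment c d)"
        "\<forall>(c, d)\<in>T. affine_on_segment h c d"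
        by (rule piecewise_affineE[where a=a and b=b, OF pa])
      have T3: "\<And>c d. (c, d) \<in> T \<Longrightarrow> affine_on_segment h c d"
        using T(3) by auto
      have "h ` closed_segment a b = (\<Union>(c, d)\<in>T. h ` closed_segment c d)"
        unfolding T(2) by (simp add: image_UN case_prod_unfold)
      also have "\<dots> = (\<Union>(c, d)\<in>T. closed_segment (h c) (h d))"
      proof (rule SUP_cong[OF refl])
        fix x assume "x \<in> T"
        then show "(case x of (c, d) \<Rightarrow> h ` closed_segment c d) =
            (case x of (c, d) \<Rightarrow> closed_segment (h c) (h d))"
          by (cases x) (simp add: affine_on_segment_image[OF T3])
      qed
      also have "\<dots> = (\<Union>(c, d)\<in>map_prod h h ` T. closed_segment c d)"
        by (simp add: case_prod_unfold)
      finally show "\<exists>T. finite T \<and> h ` closed_segment a b = (\<Union>(c, d)\<in>T. closed_segment c d) \<and>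
          (\<forall>(c, d)\<in>T. True)"
        using T(1) by (intro exI[of _ "map_prod h h ` T"]) simp
    qed
    moreover have "h ` K = (\<Union>(a, b)\<in>S. h ` closed_segment a b)"
      unfolding S(2) by (simp add: image_UN case_prod_unfold)
    ultimately show "\<exists>S. finite S \<and> h ` K = (\<Union>(a, b)\<in>S. closed_segment a b)"
      by auto
  qed
  have "pairwise disjnt ((`) h ` C)"
    using C(3) inj unfolding pairwise_def disjnt_def by (auto simp: inj_image_eq_iff image_Int[symmetric])
  then show ?thesis
    unfolding polygonal_link_def using C knot by (intro exI[of _ "(`) h ` C"]) auto
qed


section \<open>Straight points\<close>

lemma line_in_open:
  fixes u w :: "'a::real_normed_vector"
  assumes "open V" "u \<in> V"
  obtains e where "0 < e" "\<And>s. \<bar>s\<bar> < e \<Longrightarrow> u + s *\<^sub>R w \<in> V"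
proof -
  have "open ((\<lambda>s. u + s *\<^sub>R w) -` V)"
    by (intro open_vimage assms(1) continuous_intros)
  moreover have "0 \<in> (\<lambda>s. u + s *\<^sub>R w) -` V"
    using assms(2) by simp
  ultimately obtain e where e: "e > 0" "ball 0 e \<subseteq> (\<lambda>s. u + s *\<^sub>R w) -` V"
    by (meson openE)
  then show thesis
    using that[of e] by (auto simp: subset_iff dist_real_def)
qed

text \<open>With an arbitrary neighborhood in place of a round ball, and a direction in place of a second
  point, straightness can be transported by maps that are affine along the strand only.\<close>

lemma straight_at_iff:
  "straight_at D x \<longleftrightarrow>
     (\<exists>w V. w \<noteq> 0 \<and> open V \<and> x \<in> V \<and> (\<forall>p\<in>V. p \<in> D \<longleftrightarrow> (\<exists>s. p = x + s *\<^sub>R w)))" (is "?L \<longleftrightarrow> ?R")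
proof
  assume ?L
  then obtain y e where y: "y \<noteq> x" "e > 0" "D \<inter> ball x e = affine hull {x, y} \<inter> ball x e"
    unfolding straight_at_def by blast
  then have "p \<in> D \<longleftrightarrow> (\<exists>s. p = x + s *\<^sub>R (y - x))" if "p \<in> ball x e" for p
    using that unfolding affine_hull_2_alt by blast
  then show ?R
    using y by (intro exI[of _ "y - x"] exI[of _ "ball x e"]) simp
next
  assume ?R
  then obtain w V where w: "w \<noteq> 0" "open V" "x \<in> V" "\<And>p. p \<in> V \<Longrightarrow> p \<in> D \<longleftrightarrow> (\<exists>s. p = x + s *\<^sub>R w)"
    by blast
  obtain e where e: "e > 0" "ball x e \<subseteq> V"
    using w(2,3) by (meson openE)
  have "D \<inter> ball x e = affine hull {x, x + w} \<inter> ball x e"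
    unfolding affine_hull_2_alt using w(4) e(2) by (simp add: set_eq_iff image_iff subset_iff) blast
  then show ?L
    unfolding straight_at_def using w(1) e(1) by (intro exI[of _ "x + w"] exI[of _ e]) simp
qed

text \<open>Any short segment of \<open>D\<close> that starts at a straight point runs along the strand there, so its
  direction may be used as the direction of the strand.\<close>

lemma straight_at_direction:
  assumes "straight_at D u" and w: "w \<noteq> 0" and e: "0 < e"
    and D: "\<And>s. 0 < s \<Longrightarrow> s < e \<Longrightarrow> u + s *\<^sub>R w \<in> D"
  obtains V where "open V" "u \<in> V" "\<And>p. p \<in> V \<Longrightarrow> p \<in> D \<longleftrightarrow> (\<exists>s. p = u + s *\<^sub>R w)"
proof -
  obtain w0 V where V: "w0 \<noteq> 0" "open V" "u \<in> V" "\<And>p. p \<in> V \<Longrightarrow> p \<in> D \<longleftrightarrow> (\<exists>s. p = u + s *\<^sub>R w0)"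
    using assms(1) unfolding straight_at_iff by blast
  obtain d where d: "0 < d" "\<And>s. \<bar>s\<bar> < d \<Longrightarrow> u + s *\<^sub>R w \<in> V"
    using line_in_open[OF V(2,3)] by metis
  define s where "s = min d e / 2"
  have s: "0 < s" "\<bar>s\<bar> < d" "s < e"
    unfolding s_def using d e by auto
  obtain r where r: "s *\<^sub>R w = r *\<^sub>R w0"
    using V(4)[OF d(2)[OF s(2)]] D[OF s(1,3)] by auto
  have r0: "r \<noteq> 0" using r s w by auto
  have wr: "w = (r / s) *\<^sub>R w0"
    using r s by (metis divide_inverse_commute less_irrefl scaleR_scaleR scaleR_one left_inverse)
  have "(\<exists>t. p = u + t *\<^sub>R w0) \<longleftrightarrow> (\<exists>t. p = u + t *\<^sub>R w)" for p
  proof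
    assume "\<exists>t. p = u + t *\<^sub>R w0"
    then obtain t where "p = u + t *\<^sub>R w0" by blast
    then have "p = u + (t * s / r) *\<^sub>R w"
      unfolding wr using r0 s by simp
    then show "\<exists>t. p = u + t *\<^sub>R w" by blast
  qed (auto simp: wr)
  then show thesis
    using that[OF V(2,3)] V(4) by simp
qed


section \<open>Arcs near an undercrossing\<close>

definition undercrossings :: "space3 set \<Rightarrow> space3 set" where
  "undercrossings D = {u. \<exists>v. undercrossing D u v}"

text \<open>The points that remain after cutting at the undercrossings: the union of the arcs.\<close>

abbreviation over_points :: "space3 set \<Rightarrow> space3 set" where
  "over_points D \<equiv> D - undercrossings D"

lemma arcs_eq: "arcs D = connected_component_set (over_points D) ` over_points D"
  unfolding arcs_def undercrossings_def components_def by blast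

lemma undercrossing_multiple:
  assumes "undercrossing D u v"
  shows "u \<in> multiple_points D" "v \<in> multiple_points D"
proof -
  have "u \<noteq> v" using assms unfolding undercrossing_def by auto
  then show "u \<in> multiple_points D" "v \<in> multiple_points D"
    using assms unfolding undercrossing_def multiple_points_def by auto
qed

lemma finite_undercrossings: "regular_projection D \<Longrightarrow> finite (undercrossings D)"
  unfolding regular_projection_def undercrossings_def
  by (rule finite_subset[of _ "multiple_points D"]) (blast intro: undercrossing_multiple(1))+

text \<open>A point above it would be a third point on the same vertical line.\<close>

lemma over_strand_not_undercrossing:
  assumes D: "regular_projection D" and uv: "undercrossing D u v"
  shows "v \<in> over_points D"
proof -
  have "False" if vz: "undercrossing D v z" for z
  proof -
    have "u \<in> D" "v \<in> D" "z \<in> D" "fst u = fst v" "fst v = fst z" "snd u < snd v" "snd v < snd z"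
      using uv vz unfolding undercrossing_def by auto
    moreover from this have "u = v \<or> v = z \<or> u = z"
      using D unfolding regular_projection_def by blast
    ultimately show False by auto
  qed
  then show ?thesis
    using uv unfolding undercrossings_def undercrossing_def by blast
qed

lemma undercrossing_sides:
  assumes D: "regular_projection D" and uv: "undercrossing D u v"
  obtains w e where "w \<noteq> 0" "0 < e"
    "\<And>s. 0 < s \<Longrightarrow> s < e \<Longrightarrow> u + s *\<^sub>R w \<in> over_points D \<and> u - s *\<^sub>R w \<in> over_points D"
proof -
  have "straight_at D u"
    using D undercrossing_multiple(1)[OF uv] unfolding regular_projection_def by blast
  then obtain w V where V: "w \<noteq> 0" "open V" "u \<in> V" "\<And>p. p \<in> V \<Longrightarrow> p \<in> D \<longleftrightarrow> (\<exists>s. p = u + s *\<^sub>R w)"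
    unfolding straight_at_iff by blast
  let ?V = "V - (undercrossings D - {u})"
  have "open ?V" "u \<in> ?V"
    using V finite_undercrossings[OF D] by (auto intro!: open_Diff finite_imp_closed)
  then obtain e where e: "0 < e" "\<And>s. \<bar>s\<bar> < e \<Longrightarrow> u + s *\<^sub>R w \<in> ?V"
    using line_in_open by metis
  show thesis
  proof (rule that[OF V(1) e(1)])
    fix s assume s: "0 < s" "s < e"
    have "u + r *\<^sub>R w \<in> over_points D" if "\<bar>r\<bar> < e" "r \<noteq> 0" for r
      using e(2)[OF that(1)] V(1,4) that(2) by auto
    from this[of s] this[of "- s"] show "u + s *\<^sub>R w \<in> over_points D \<and> u - s *\<^sub>R w \<in> over_points D"
      using s by simp
  qed
qed

lemma connected_ray: "connected ((\<lambda>s. u + s *\<^sub>R (w :: 'a::real_normed_vector)) ` {0<..<e})"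
  by (intro connected_continuous_image continuous_intros) simp

text \<open>Each of the two rays leaving the undercrossing is connected, hence lies in one arc, which has \<open>u\<close> in
  its closure. Conversely an arc with \<open>u\<close> in its closure has points close to \<open>u\<close>, and these lie on one
  of the two rays since \<open>D\<close> is straight at \<open>u\<close>.\<close>

lemma arcs_at_undercrossing:
  assumes D: "regular_projection D" and uv: "undercrossing D u v" and w: "w \<noteq> 0"
    and sides: "\<And>s. 0 < s \<Longrightarrow> s < e \<Longrightarrow> u + s *\<^sub>R w \<in> over_points D \<and> u - s *\<^sub>R w \<in> over_points D"
    and s: "0 < s" "s < e"
  shows "{X \<in> arcs D. u \<in> closure X} =
    {connected_component_set (over_points D) (u + s *\<^sub>R w),
     connected_component_set (over_points D) (u - s *\<^sub>R w)}"
proof -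
  let ?C = "connected_component_set (over_points D)"
  have ray: "u + t *\<^sub>R w' \<in> ?C (u + s *\<^sub>R w')" if "0 < t" "t < e" "w' = w \<or> w' = - w" for t w'
  proof -
    have "(\<lambda>s. u + s *\<^sub>R w') ` {0<..<e} \<subseteq> over_points D"
      using sides that(3) by auto
    then have "connected_component (over_points D) (u + s *\<^sub>R w') (u + t *\<^sub>R w')"
      unfolding connected_component_def
      using that s by (intro exI[of _ "(\<lambda>s. u + s *\<^sub>R w') ` {0<..<e}"]) (auto simp: connected_ray)
    then show ?thesis by simp
  qed
  have cl: "u \<in> closure (?C (u + s *\<^sub>R w'))" if w': "w' = w \<or> w' = - w" for w'
    unfolding closure_iff_nhds_not_empty
  proof (intro allI impI)
    fix A V assume V: "V \<subseteq> A" "open V" "u \<in> V"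
    obtain d where d: "0 < d" "\<And>s. \<bar>s\<bar> < d \<Longrightarrow> u + s *\<^sub>R w' \<in> V"
      using line_in_open[OF V(2,3)] by metis
    define t where "t = min d e / 2"
    have "0 < t" "\<bar>t\<bar> < d" "t < e"
      unfolding t_def using d(1) s by auto
    then have "u + t *\<^sub>R w' \<in> ?C (u + s *\<^sub>R w') \<inter> A"
      using d(2) V(1) ray w' by blast
    then show "?C (u + s *\<^sub>R w') \<inter> A \<noteq> {}" by blast
  qed
  have "straight_at D u"
    using D undercrossing_multiple(1)[OF uv] unfolding regular_projection_def by blast
  then obtain V where V: "open V" "u \<in> V" "\<And>p. p \<in> V \<Longrightarrow> p \<in> D \<longleftrightarrow> (\<exists>s. p = u + s *\<^sub>R w)"
    by (rule straight_at_direction[OF _ w, of D u e]) (use sides s in auto)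
  have only: "X = ?C (u + s *\<^sub>R w) \<or> X = ?C (u - s *\<^sub>R w)"
    if X: "X \<in> arcs D" "u \<in> closure X" for X
  proof -
    have "0 < e" using s by simp
    have "u \<in> V \<inter> ball u (e * norm w)" using V \<open>0 < e\<close> w by simp
    moreover have "open (V \<inter> ball u (e * norm w))" using V by blast
    ultimately have "X \<inter> (V \<inter> ball u (e * norm w)) \<noteq> {}"
      using X(2) unfolding closure_iff_nhds_not_empty by blast
    then obtain x where x: "x \<in> X" "x \<in> V" "dist u x < e * norm w" by auto
    obtain y where y: "y \<in> over_points D" "X = ?C y"
      using X(1) unfolding arcs_eq by blast
    have Xo: "X \<subseteq> over_points D" using y connected_component_subset by blast
    then obtain r where r: "x = u + r *\<^sub>R w" using V(3)[OF x(2)] x(1) by blast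
    have "u \<in> undercrossings D" using uv unfolding undercrossings_def by blast
    then have "r \<noteq> 0" using r x(1) Xo by auto
    have "\<bar>r\<bar> < e" using x(3) w unfolding r by (simp add: dist_norm)
    define w' where "w' = (if r > 0 then w else - w)"
    have "x = u + \<bar>r\<bar> *\<^sub>R w'" unfolding r w'_def using \<open>r \<noteq> 0\<close> by auto
    then have "x \<in> ?C (u + s *\<^sub>R w')"
      using ray[of "\<bar>r\<bar>" w'] \<open>r \<noteq> 0\<close> \<open>\<bar>r\<bar> < e\<close> unfolding w'_def by auto
    then have "X = ?C (u + s *\<^sub>R w')"
      using x(1) y(2) by (metis connected_component_eq)
    then show ?thesis unfolding w'_def by (auto split: if_splits)
  qed
  have "?C (u + s *\<^sub>R w) \<in> arcs D" "?C (u - s *\<^sub>R w) \<in> arcs D"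
    unfolding arcs_eq using sides[OF s] by blast+
  moreover have "u \<in> closure (?C (u + s *\<^sub>R w))" "u \<in> closure (?C (u - s *\<^sub>R w))"
    using cl[of w] cl[of "- w"] by simp_all
  ultimately show ?thesis using only by blast
qed


section \<open>Colorings of points\<close>

text \<open>The strand under the crossing at \<open>u\<close> has direction \<open>w\<close>; it has color \<open>a\<close> just after \<open>u\<close> in this
  direction, and color \<open>c\<close> just before.\<close>

definition side_colors ::
  "nat \<Rightarrow> space3 set \<Rightarrow> (space3 \<Rightarrow> int) \<Rightarrow> space3 \<Rightarrow> space3 \<Rightarrow> int \<Rightarrow> int \<Rightarrow> bool" where
  "side_colors p D \<kappa> u w a c \<longleftrightarrow>
     (\<exists>e>0. \<forall>s. 0 < s \<and> s < e \<longrightarrow>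
        u + s *\<^sub>R w \<in> over_points D \<and> u - s *\<^sub>R w \<in> over_points D \<and>
        [\<kappa> (u + s *\<^sub>R w) = a] (mod int p) \<and> [\<kappa> (u - s *\<^sub>R w) = c] (mod int p))"

text \<open>Constancy on connected sets expresses that the color depends on the arc only. The crossing
  condition is tested on the two sides of \<open>u\<close>, without naming the arcs.\<close>

definition point_coloring :: "nat \<Rightarrow> space3 set \<Rightarrow> (space3 \<Rightarrow> int) \<Rightarrow> bool" where
  "point_coloring p D \<kappa> \<longleftrightarrow>
     \<kappa> ` over_points D \<subseteq> {0..<int p} \<and>
     (\<forall>S. connected S \<and> S \<subseteq> over_points D \<longrightarrow> \<kappa> constant_on S) \<and>
     (\<forall>u v. undercrossing D u v \<longrightarrow>
        (\<exists>w a. w \<noteq> 0 \<and> side_colors p D \<kappa> u w a (2 * \<kappa> v - a)))"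

definition color_at :: "space3 set \<Rightarrow> (space3 set \<Rightarrow> int) \<Rightarrow> space3 \<Rightarrow> int" where
  "color_at D c x = c (connected_component_set (over_points D) x)"

lemma color_at_image: "color_at D c ` over_points D = c ` arcs D"
  unfolding arcs_eq color_at_def by (simp add: image_image)

lemma color_at_arc:
  assumes "X \<in> arcs D" "x \<in> X"
  shows "color_at D c x = c X"
  using assms connected_component_eq unfolding arcs_eq color_at_def by fastforce

lemma color_at_constant:
  assumes "connected S" "S \<subseteq> over_points D" "x \<in> S" "y \<in> S"
  shows "color_at D c x = color_at D c y"
proof -
  have "y \<in> connected_component_set (over_points D) x"
    using assms unfolding connected_component_def mem_Collect_eq by blast
  then show ?thesis
    unfolding color_at_def by (metis connected_component_eq)
qed

lemma side_colors_uminus: "side_colors p D \<kappa> u w a c \<Longrightarrow> side_colors p D \<kappa> u (- w) c a"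
  unfolding side_colors_def by auto

lemma side_colors_color_at:
  assumes "0 < e" "\<And>s. 0 < s \<Longrightarrow> s < e \<Longrightarrow> u + s *\<^sub>R w \<in> over_points D \<and> u - s *\<^sub>R w \<in> over_points D"
    and s: "0 < s" "s < e"
  shows "side_colors p D (color_at D c) u w (color_at D c (u + s *\<^sub>R w)) (color_at D c (u - s *\<^sub>R w))"
proof -
  have "color_at D c (u + t *\<^sub>R w') = color_at D c (u + s *\<^sub>R w')"
    if "0 < t" "t < e" "w' = w \<or> w' = - w" for t w'
    by (rule color_at_constant[OF connected_ray[of u w' e]]) (use that s assms(2) in auto)
  from this[of _ w] this[of _ "- w"] show ?thesis
    unfolding side_colors_def using assms(1,2) by (intro exI[of _ e]) simp
qed

text \<open>The two under-arcs of a crossing come in either order; the direction \<open>w\<close> is chosen such that the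
  arc \<open>B\<close> lies ahead.\<close>

lemma crossing_side_colors:
  assumes D: "regular_projection D" and ABC: "crossing D A B C"
  obtains u v w where "undercrossing D u v" "w \<noteq> 0" "color_at D c v = c A"
    "side_colors p D (color_at D c) u w (c B) (c C)"
proof -
  obtain u v where uv: "undercrossing D u v" and A: "A \<in> arcs D" "v \<in> A"
    and BC: "{X \<in> arcs D. u \<in> closure X} = {B, C}"
    using ABC unfolding crossing_def by blast
  obtain w e where w: "w \<noteq> 0" and e: "0 < e"
    and sides: "\<And>s. 0 < s \<Longrightarrow> s < e \<Longrightarrow> u + s *\<^sub>R w \<in> over_points D \<and> u - s *\<^sub>R w \<in> over_points D"
    using undercrossing_sides[OF D uv] by metis
  have s: "0 < e / 2" "e / 2 < e" using e by auto
  let ?C = "connected_component_set (over_points D)"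
  have "{B, C} = {?C (u + (e / 2) *\<^sub>R w), ?C (u - (e / 2) *\<^sub>R w)}"
    using arcs_at_undercrossing[OF D uv w sides s] BC by simp
  moreover note sc = side_colors_color_at[OF e sides s, of p c]
  moreover have "color_at D c v = c A" using color_at_arc[OF A] .
  ultimately show thesis
    using that[OF uv w] that[OF uv, of "- w"] w side_colors_uminus[OF sc]
    unfolding color_at_def doubleton_eq_iff by auto
qed

lemma point_coloring_color_at:
  assumes D: "regular_projection D" and c: "coloring p D c"
  shows "point_coloring p D (color_at D c)"
  unfolding point_coloring_def
proof (intro conjI allI impI)
  show "color_at D c ` over_points D \<subseteq> {0..<int p}"
    unfolding color_at_image using c unfolding coloring_def by blast
  show "color_at D c constant_on S" if "connected S \<and> S \<subseteq> over_points D" for S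
  proof (cases "S = {}")
    case False
    then obtain x where "x \<in> S" by blast
    then show ?thesis
      using color_at_constant[of S D _ x c] that unfolding constant_on_def by blast
  qed (simp add: constant_on_def)
  fix u v assume uv: "undercrossing D u v"
  obtain w e where w: "w \<noteq> 0" and e: "0 < e"
    and sides: "\<And>s. 0 < s \<Longrightarrow> s < e \<Longrightarrow> u + s *\<^sub>R w \<in> over_points D \<and> u - s *\<^sub>R w \<in> over_points D"
    using undercrossing_sides[OF D uv] by metis
  have s: "0 < e / 2" "e / 2 < e" using e by auto
  let ?C = "connected_component_set (over_points D)"
  have v: "v \<in> over_points D" by (rule over_strand_not_undercrossing[OF D uv])
  have "crossing D (?C v) (?C (u + (e / 2) *\<^sub>R w)) (?C (u - (e / 2) *\<^sub>R w))"
    unfolding crossing_def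
    using uv arcs_at_undercrossing[OF D uv w sides s] v unfolding arcs_eq
    by (intro exI[of _ u] exI[of _ v]) auto
  then have "[2 * color_at D c v = color_at D c (u + (e / 2) *\<^sub>R w) + color_at D c (u - (e / 2) *\<^sub>R w)] (mod int p)"
    using c unfolding coloring_def color_at_def by blast
  then have "[color_at D c (u - (e / 2) *\<^sub>R w) = 2 * color_at D c v - color_at D c (u + (e / 2) *\<^sub>R w)] (mod int p)"
    by (smt (verit) cong_iff_dvd_diff dvd_minus_iff)
  then have "side_colors p D (color_at D c) u w (color_at D c (u + (e / 2) *\<^sub>R w))
      (2 * color_at D c v - color_at D c (u + (e / 2) *\<^sub>R w))"
    using side_colors_color_at[OF e sides s, of p c] unfolding side_colors_def by (meson cong_trans)
  then show "\<exists>w a. w \<noteq> 0 \<and> side_colors p D (color_at D c) u w a (2 * color_at D c v - a)"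
    using w by blast
qed

text \<open>An arc is connected, so it receives the color of an arbitrarily chosen point on it.\<close>

lemma coloring_of_point_coloring:
  assumes D: "regular_projection D" and \<kappa>: "point_coloring p D \<kappa>"
  obtains c where "coloring p D c" "c ` arcs D = \<kappa> ` over_points D"
proof -
  define c where "c = (\<lambda>X. \<kappa> (SOME x. x \<in> X))"
  have cX: "c X = \<kappa> x" if X: "X \<in> arcs D" "x \<in> X" for X x
  proof -
    have "connected X" "X \<subseteq> over_points D"
      using X(1) connected_component_subset unfolding arcs_eq by auto
    then have "\<kappa> constant_on X" using \<kappa> unfolding point_coloring_def by blast
    moreover have "(SOME x. x \<in> X) \<in> X" using X(2) by (rule someI)
    ultimately show ?thesis using X(2) unfolding c_def constant_on_def by auto
  qed
  let ?C = "connected_component_set (over_points D)"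
  have cC: "c (?C x) = \<kappa> x" if "x \<in> over_points D" for x
    by (rule cX) (use that in \<open>auto simp: arcs_eq\<close>)
  have im: "c ` arcs D = \<kappa> ` over_points D"
    unfolding arcs_eq image_image using cC by (intro image_cong) auto
  have "coloring p D c"
    unfolding coloring_def
  proof (intro conjI ballI allI impI)
    show "c A \<in> {0..<int p}" if "A \<in> arcs D" for A
      using \<kappa> im that unfolding point_coloring_def by blast
    fix A B C assume "crossing D A B C"
    then obtain u v where uv: "undercrossing D u v" and A: "A \<in> arcs D" "v \<in> A"
      and BC: "{X \<in> arcs D. u \<in> closure X} = {B, C}"
      unfolding crossing_def by blast
    obtain w a where w: "w \<noteq> 0" and sc: "side_colors p D \<kappa> u w a (2 * \<kappa> v - a)"
      using \<kappa> uv unfolding point_coloring_def by blast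
    obtain e where e: "0 < e"
      and sides: "\<And>s. 0 < s \<Longrightarrow> s < e \<Longrightarrow> u + s *\<^sub>R w \<in> over_points D \<and> u - s *\<^sub>R w \<in> over_points D"
      and cong: "\<And>s. 0 < s \<Longrightarrow> s < e \<Longrightarrow> [\<kappa> (u + s *\<^sub>R w) = a] (mod int p)
          \<and> [\<kappa> (u - s *\<^sub>R w) = 2 * \<kappa> v - a] (mod int p)"
      using sc unfolding side_colors_def by blast
    have s: "0 < e / 2" "e / 2 < e" using e by auto
    have "{B, C} = {?C (u + (e / 2) *\<^sub>R w), ?C (u - (e / 2) *\<^sub>R w)}"
      using arcs_at_undercrossing[OF D uv w sides s] BC by simp
    then have sum: "c B + c C = \<kappa> (u + (e / 2) *\<^sub>R w) + \<kappa> (u - (e / 2) *\<^sub>R w)"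
      using cC[of "u + (e / 2) *\<^sub>R w"] cC[of "u - (e / 2) *\<^sub>R w"] sides[OF s]
      unfolding doubleton_eq_iff by fastforce
    have "[\<kappa> (u + (e / 2) *\<^sub>R w) + \<kappa> (u - (e / 2) *\<^sub>R w) = a + (2 * \<kappa> v - a)] (mod int p)"
      using cong[OF s] by (intro cong_add) auto
    then show "[2 * c A = c B + c C] (mod int p)"
      unfolding sum cX[OF A] by (simp add: cong_sym_eq)
  qed
  then show thesis using that im by blast
qed


section \<open>Linear charts at a crossing\<close>

text \<open>Coordinates in which the plane of projection and the vertical direction are respected: two points
  lie on a vertical line iff their first two coordinates agree, and the third one measures height.
  The vectors \<open>d_over\<close> and \<open>d_under\<close> will be directions of the two strands at a crossing, and \<open>u\<close> the
  origin.\<close>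

locale chart =
  fixes u d_over d_under \<eta> :: space3 and X Y Z :: "space3 \<Rightarrow> real"
  assumes linear: "linear X" "linear Y" "linear Z"
    and X: "X d_over = 1" "X d_under = 0" "X \<eta> = 0"
    and Y: "Y d_over = 0" "Y d_under = 1" "Y \<eta> = 0"
    and Z: "Z d_over = 0" "Z d_under = 0" "Z \<eta> = 1"
    and expand: "\<And>p. p = X p *\<^sub>R d_over + Y p *\<^sub>R d_under + Z p *\<^sub>R \<eta>"
    and vertical: "fst \<eta> = 0" "0 < snd \<eta>"
begin

definition dir :: "real \<Rightarrow> real \<Rightarrow> real \<Rightarrow> space3" where
  "dir a b c = a *\<^sub>R d_over + b *\<^sub>R d_under + c *\<^sub>R \<eta>"

definition pt :: "real \<Rightarrow> real \<Rightarrow> real \<Rightarrow> space3" where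
  "pt a b c = u + dir a b c"

definition cx :: "space3 \<Rightarrow> real" where "cx p = X (p - u)"
definition cy :: "space3 \<Rightarrow> real" where "cy p = Y (p - u)"
definition cz :: "space3 \<Rightarrow> real" where "cz p = Z (p - u)"

lemma coordinates_dir: "X (dir a b c) = a" "Y (dir a b c) = b" "Z (dir a b c) = c"
  unfolding dir_def using linear
  by (simp_all add: linear_add linear_scale X Y Z)

lemma coordinates_pt [simp]: "cx (pt a b c) = a" "cy (pt a b c) = b" "cz (pt a b c) = c"
  unfolding pt_def cx_def cy_def cz_def by (simp_all add: coordinates_dir)

lemma pt_coordinates: "pt (cx p) (cy p) (cz p) = p"
  using expand[of "p - u"] unfolding pt_def dir_def cx_def cy_def cz_def by (simp add: algebra_simps)

lemma pt_eqI: "cx p = a \<Longrightarrow> cy p = b \<Longrightarrow> cz p = c \<Longrightarrow> p = pt a b c"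
  using pt_coordinates[of p] by simp

lemma pt_eq_iff [simp]: "pt a b c = pt a' b' c' \<longleftrightarrow> a = a' \<and> b = b' \<and> c = c'"
  by (metis coordinates_pt)

lemma coordinates_add [simp]:
  "cx (p + s *\<^sub>R dir a b c) = cx p + s * a"
  "cy (p + s *\<^sub>R dir a b c) = cy p + s * b"
  "cz (p + s *\<^sub>R dir a b c) = cz p + s * c"
proof -
  have *: "p + s *\<^sub>R dir a b c - u = (p - u) + s *\<^sub>R dir a b c" by simp
  show "cx (p + s *\<^sub>R dir a b c) = cx p + s * a"
    "cy (p + s *\<^sub>R dir a b c) = cy p + s * b"
    "cz (p + s *\<^sub>R dir a b c) = cz p + s * c"
    unfolding cx_def cy_def cz_def * using linear
    by (simp_all add: linear_add linear_scale coordinates_dir)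
qed

lemma pt_add: "pt x y z + s *\<^sub>R dir a b c = pt (x + s * a) (y + s * b) (z + s * c)"
  by (rule pt_eqI) simp_all

lemma dir_nonzero: "(a, b, c) \<noteq> (0, 0, 0) \<Longrightarrow> dir a b c \<noteq> 0"
  using coordinates_dir[of a b c] linear_0 linear by metis

lemma vertical_difference:
  assumes "cx p = cx q" "cy p = cy q"
  shows "p = q + (cz p - cz q) *\<^sub>R dir 0 0 1"
proof -
  have "q + (cz p - cz q) *\<^sub>R dir 0 0 1 = pt (cx p) (cy p) (cz p)"
    by (rule pt_eqI) (simp_all add: assms)
  then show ?thesis by (simp add: pt_coordinates)
qed

lemma fst_eq_iff: "fst p = fst q \<longleftrightarrow> cx p = cx q \<and> cy p = cy q"
proof
  assume "fst p = fst q"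
  then have "p - q = ((snd p - snd q) / snd \<eta>) *\<^sub>R \<eta>"
    using vertical by (intro prod_eqI) (simp_all add: fst_diff snd_diff)
  then have p: "p - u = (q - u) + ((snd p - snd q) / snd \<eta>) *\<^sub>R \<eta>"
    by (metis add.commute diff_add_cancel diff_add_eq)
  show "cx p = cx q \<and> cy p = cy q"
    unfolding cx_def cy_def p using linear by (simp add: linear_add linear_scale X Y)
next
  assume eq: "cx p = cx q \<and> cy p = cy q"
  then have "p = q + (cz p - cz q) *\<^sub>R dir 0 0 1"
    using vertical_difference by blast
  then have "fst p = fst (q + (cz p - cz q) *\<^sub>R dir 0 0 1)" by (rule arg_cong)
  also have "\<dots> = fst q"
    using vertical by (simp add: dir_def)
  finally show "fst p = fst q" .
qed

lemma snd_less_iff: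
  assumes "fst p = fst q"
  shows "snd p < snd q \<longleftrightarrow> cz p < cz q"
proof -
  have "cx p = cx q" "cy p = cy q" using assms fst_eq_iff by auto
  then have "p = q + (cz p - cz q) *\<^sub>R dir 0 0 1"
    using vertical_difference by blast
  then have "snd p = snd (q + (cz p - cz q) *\<^sub>R dir 0 0 1)" by (rule arg_cong)
  also have "\<dots> = snd q + (cz p - cz q) * snd \<eta>"
    by (simp add: dir_def)
  finally show ?thesis
    using vertical(2) by (simp add: mult_less_0_iff)
qed

lemma continuous_coordinates [continuous_intros]:
  "continuous_on S cx" "continuous_on S cy" "continuous_on S cz"
  unfolding cx_def cy_def cz_def
  by (rule continuous_on_compose2[OF linear_continuous_on[of _ UNIV]];
      auto intro!: continuous_intros simp: linear linear_conv_bounded_linear[symmetric])+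

lemma affine_coordinates:
  "affine_on_segment cx a b" "affine_on_segment cy a b" "affine_on_segment cz a b"
proof -
  have *: "(1 - t) *\<^sub>R a + t *\<^sub>R b - u = (1 - t) *\<^sub>R (a - u) + t *\<^sub>R (b - u)" for t
    by (simp add: algebra_simps)
  show "affine_on_segment cx a b" "affine_on_segment cy a b" "affine_on_segment cz a b"
    unfolding affine_on_segment_def cx_def cy_def cz_def * using linear
    by (simp_all add: linear_add linear_scale)
qed

end

text \<open>The plane coordinates are given by Cramer's rule; the height is what remains of the vertical
  component.\<close>

lemma chart_exists:
  assumes det: "fst (fst d_over) * snd (fst d_under) \<noteq> snd (fst d_over) * fst (fst d_under)"
    and vertical: "fst \<eta> = 0" "0 < snd \<eta>"
  shows "\<exists>X Y Z. chart d_over d_under \<eta> X Y Z"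
proof -
  define d where "d = fst (fst d_over) * snd (fst d_under) - snd (fst d_over) * fst (fst d_under)"
  have d: "d \<noteq> 0" using det unfolding d_def by simp
  define X where "X = (\<lambda>p :: space3. (fst (fst p) * snd (fst d_under) - snd (fst p) * fst (fst d_under)) / d)"
  define Y where "Y = (\<lambda>p :: space3. (fst (fst d_over) * snd (fst p) - snd (fst d_over) * fst (fst p)) / d)"
  define Z where "Z = (\<lambda>p :: space3. (snd p - X p * snd d_over - Y p * snd d_under) / snd \<eta>)"
  have XY: "linear X" "linear Y"
    unfolding X_def Y_def
    by (rule linearI; simp add: algebra_simps add_divide_distrib diff_divide_distrib)+
  have lZ: "linear Z"
    unfolding Z_def
    by (rule linearI)
      (simp_all add: linear_add[OF XY(1)] linear_add[OF XY(2)] linear_scale[OF XY(1)] linear_scale[OF XY(2)]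
        algebra_simps add_divide_distrib diff_divide_distrib)
  have vals: "X d_over = 1" "X d_under = 0" "X \<eta> = 0" "Y d_over = 0" "Y d_under = 1" "Y \<eta> = 0"
    using d vertical unfolding X_def Y_def by (simp_all add: d_def mult.commute)
  have Zv: "Z d_over = 0" "Z d_under = 0" "Z \<eta> = 1"
    unfolding Z_def using vals vertical by simp_all
  have "p = X p *\<^sub>R d_over + Y p *\<^sub>R d_under + Z p *\<^sub>R \<eta>" for p
  proof (rule prod_eqI; (rule prod_eqI)?)
    have "X p * fst (fst d_over) + Y p * fst (fst d_under) = fst (fst p) * d / d"
      unfolding X_def Y_def by (simp add: d_def algebra_simps flip: add_divide_distrib)
    then show "fst (fst p) = fst (fst (X p *\<^sub>R d_over + Y p *\<^sub>R d_under + Z p *\<^sub>R \<eta>))"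
      using d vertical by simp
    have "X p * snd (fst d_over) + Y p * snd (fst d_under) = snd (fst p) * d / d"
      unfolding X_def Y_def by (simp add: d_def algebra_simps flip: add_divide_distrib)
    then show "snd (fst p) = snd (fst (X p *\<^sub>R d_over + Y p *\<^sub>R d_under + Z p *\<^sub>R \<eta>))"
      using d vertical by simp
    show "snd p = snd (X p *\<^sub>R d_over + Y p *\<^sub>R d_under + Z p *\<^sub>R \<eta>)"
      unfolding Z_def using vertical by simp
  qed
  note expand = this
  have "chart d_over d_under \<eta> X Y Z"
    by (intro chart.intro) (fact XY lZ vals Zv vertical expand)+
  then show ?thesis by blast
qed

text \<open>Over the square of radius \<open>10\<close> the diagram consists of an upper strand, the first axis at
  height \<open>1\<close>, and a lower strand, the second axis at height \<open>0\<close>. The radius is chosen such that the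
  finger move below fits into the square.\<close>

locale crossing_chart = chart +
  fixes D :: "space3 set"
  assumes near: "\<And>p. \<bar>cx p\<bar> < 10 \<Longrightarrow> \<bar>cy p\<bar> < 10 \<Longrightarrow>
      p \<in> D \<longleftrightarrow> cx p = 0 \<and> cz p = 0 \<or> cy p = 0 \<and> cz p = 1"

lemma compact_polygonal_link: "polygonal_link L \<Longrightarrow> compact L"
proof -
  assume "polygonal_link L"
  then obtain C where C: "finite C" "\<forall>K\<in>C. polygonal_knot K" "L = \<Union>C"
    unfolding polygonal_link_def by blast
  have "compact K" if "K \<in> C" for K
  proof -
    have "polygonal_knot K" using C(2) that by blast
    then have "\<exists>g. simple_path g \<and> pathfinish g = pathstart g \<and> path_image g = K"
      unfolding polygonal_knot_def by (rule conjunct1)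
    then obtain g where "simple_path g" "path_image g = K"
      by (elim exE conjE)
    then show ?thesis
      using compact_path_image simple_path_imp_path by blast
  qed
  then show "compact L" using C(1,3) by (simp add: compact_Union)
qed

text \<open>If the two projected strands were parallel, they would overlap in a segment, and all of its points
  would be projections of multiple points. The vanishing determinant also covers a vertical strand.\<close>

lemma projections_transversal:
  assumes D: "finite (multiple_points D)" and uv: "fst u = fst v" "snd u < snd v"
    and w: "w \<noteq> 0" "0 < d" "\<And>s. \<bar>s\<bar> < d \<Longrightarrow> u + s *\<^sub>R w \<in> D"
    and w': "w' \<noteq> 0" "0 < d'" "\<And>s. \<bar>s\<bar> < d' \<Longrightarrow> v + s *\<^sub>R w' \<in> D"
  shows "fst (fst w') * snd (fst w) \<noteq> snd (fst w') * fst (fst w)"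
proof
  assume det: "fst (fst w') * snd (fst w) = snd (fst w') * fst (fst w)"
  obtain l m where lm: "l \<noteq> 0 \<or> m \<noteq> 0" "l *\<^sub>R fst w = m *\<^sub>R fst w'"
  proof (cases "fst w' = 0")
    case True
    then show thesis using that[of 0 1] by simp
  next
    case False
    show thesis
    proof (cases "fst (fst w') = 0")
      case True
      then have s: "snd (fst w') \<noteq> 0" using False by (simp add: prod_eq_iff)
      then have "fst (fst w) = 0" using det True by simp
      then show thesis using that[of "snd (fst w')" "snd (fst w)"] s True by (simp add: prod_eq_iff)
    next
      case nz: False
      then show thesis
        using that[of "fst (fst w')" "fst (fst w)"] det by (simp add: prod_eq_iff mult.commute)
    qed
  qed
  let ?K = "m * snd w' - l * snd w"
  \<comment> \<open>The last set keeps the strand through \<open>v\<close> above the strand through \<open>u\<close>.\<close>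
  let ?V = "{s. \<bar>s * l\<bar> < d} \<inter> {s. \<bar>s * m\<bar> < d'} \<inter> {s. 0 < snd v - snd u + s * ?K}"
  have "open ?V"
    by (intro open_Int open_Collect_less continuous_intros)
  moreover have "0 \<in> ?V" using w w' uv by simp
  ultimately obtain e where e: "0 < e" "\<And>s. \<bar>s\<bar> < e \<Longrightarrow> (0::real) + s *\<^sub>R 1 \<in> ?V"
    using line_in_open by metis
  have mult: "u + (s * l) *\<^sub>R w \<in> multiple_points D" "v + (s * m) *\<^sub>R w' \<in> multiple_points D"
    if "0 < s" "s < e" for s
  proof -
    have s: "\<bar>s * l\<bar> < d" "\<bar>s * m\<bar> < d'" "0 < snd v - snd u + s * ?K"
      using e(2)[of s] that by auto
    have "u + (s * l) *\<^sub>R w \<in> D" "v + (s * m) *\<^sub>R w' \<in> D" using w w' s by auto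
    moreover have "fst (u + (s * l) *\<^sub>R w) = fst (v + (s * m) *\<^sub>R w')"
      using uv(1) lm(2) by (simp flip: scaleR_scaleR)
    moreover have "snd (u + (s * l) *\<^sub>R w) \<noteq> snd (v + (s * m) *\<^sub>R w')"
      using s(3) by (simp add: algebra_simps)
    then have "u + (s * l) *\<^sub>R w \<noteq> v + (s * m) *\<^sub>R w'" by metis
    ultimately show "u + (s * l) *\<^sub>R w \<in> multiple_points D" "v + (s * m) *\<^sub>R w' \<in> multiple_points D"
      unfolding multiple_points_def mem_Collect_eq by metis+
  qed
  have "infinite {0<..<e}" using e(1) by simp
  show False
  proof (cases "l = 0")
    case False
    have "inj_on (\<lambda>s. u + (s * l) *\<^sub>R w) {0<..<e}"
      using False w(1) by (simp add: inj_on_def)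
    moreover have "(\<lambda>s. u + (s * l) *\<^sub>R w) ` {0<..<e} \<subseteq> multiple_points D"
      using mult(1) by (meson greaterThanLessThan_iff image_subsetI)
    ultimately show False
      using D \<open>infinite {0<..<e}\<close> inj_on_finite by blast
  next
    case True
    then have "m \<noteq> 0" using lm by simp
    then have "inj_on (\<lambda>s. v + (s * m) *\<^sub>R w') {0<..<e}"
      using w'(1) by (simp add: inj_on_def)
    moreover have "(\<lambda>s. v + (s * m) *\<^sub>R w') ` {0<..<e} \<subseteq> multiple_points D"
      using mult(2) by (meson greaterThanLessThan_iff image_subsetI)
    ultimately show False
      using D \<open>infinite {0<..<e}\<close> inj_on_finite by blast
  qed
qed

text \<open>By compactness, over a small disc around the projected crossing the diagram stays close to the two
  points of the crossing, where it is straight. Scaling the two directions by a small factor makes the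
  square of the chart project into this disc. The direction \<open>w\<close> is reversed so that the half of the
  lower strand behind the undercrossing, which has color \<open>2 * b - a\<close> in the application, becomes the
  positive half of the second axis.\<close>

lemma crossing_chart_exists:
  assumes D: "polygonal_link D" "regular_projection D" and uv: "undercrossing D u v"
    and w: "w \<noteq> 0" "0 < e" "\<And>s. 0 < s \<Longrightarrow> s < e \<Longrightarrow> u + s *\<^sub>R w \<in> D"
  obtains r d_over d_under \<eta> X Y Z where "0 < r" "d_under = - r *\<^sub>R w" "\<eta> = v - u"
    "crossing_chart u d_over d_under \<eta> X Y Z D"
proof -
  have u: "u \<in> D" "v \<in> D" "fst u = fst v" "snd u < snd v"
    using uv unfolding undercrossing_def by auto
  have su: "straight_at D u" and sv: "straight_at D v" and fin: "finite (multiple_points D)"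
    using D(2) undercrossing_multiple[OF uv] unfolding regular_projection_def by auto
  obtain V where V: "open V" "u \<in> V" "\<And>p. p \<in> V \<Longrightarrow> p \<in> D \<longleftrightarrow> (\<exists>s. p = u + s *\<^sub>R w)"
    by (rule straight_at_direction[OF su w(1,2)]) (use w(3) in auto)
  obtain w' V' where V': "w' \<noteq> 0" "open V'" "v \<in> V'" "\<And>p. p \<in> V' \<Longrightarrow> p \<in> D \<longleftrightarrow> (\<exists>s. p = v + s *\<^sub>R w')"
    using sv unfolding straight_at_iff by blast
  obtain d where d: "0 < d" "\<And>s. \<bar>s\<bar> < d \<Longrightarrow> u + s *\<^sub>R w \<in> V"
    using line_in_open[OF V(1,2)] by metis
  obtain d' where d': "0 < d'" "\<And>s. \<bar>s\<bar> < d' \<Longrightarrow> v + s *\<^sub>R w' \<in> V'"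
    using line_in_open[OF V'(2,3)] by metis
  have uD: "u + s *\<^sub>R w \<in> D" if "\<bar>s\<bar> < d" for s using V(3) d(2) that by blast
  have vD: "v + s *\<^sub>R w' \<in> D" if "\<bar>s\<bar> < d'" for s using V'(4) d'(2) that by blast
  have det: "fst (fst w') * snd (fst w) \<noteq> snd (fst w') * fst (fst w)"
    by (rule projections_transversal[OF fin u(3,4) w(1) d(1) uD V'(1) d'(1) vD])
  have "compact (fst ` (D - (V \<union> V')))"
    using compact_polygonal_link[OF D(1)] V(1) V'(2)
    by (intro compact_continuous_image compact_diff continuous_intros) auto
  then have "open (- (fst ` (D - (V \<union> V'))))"
    by (simp add: compact_imp_closed open_Compl)
  moreover have "fst u \<notin> fst ` (D - (V \<union> V'))"
  proof
    assume "fst u \<in> fst ` (D - (V \<union> V'))"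
    then obtain p where "fst u = fst p" "p \<in> D - (V \<union> V')" by (rule imageE)
    then have p: "p \<in> D" "p \<notin> V" "p \<notin> V'" "fst p = fst u" by simp_all
    have "p = u \<or> u = v \<or> p = v"
      using D(2) p(1,4) u unfolding regular_projection_def by metis
    then show False using p V V' u(4) by auto
  qed
  ultimately obtain \<delta> where \<delta>: "0 < \<delta>" "ball (fst u) \<delta> \<subseteq> - (fst ` (D - (V \<union> V')))"
    by (meson ComplI openE)
  \<comment> \<open>The square of radius \<open>10\<close> must map into the disc and the lower and upper axes into \<open>V\<close> and \<open>V'\<close>; the
    factor \<open>11\<close> makes an estimate strict.\<close>
  define r where "r = min (min (d / 10) (d' / 10)) (\<delta> / (11 * (norm (fst w) + norm (fst w') + 1)))"
  have N: "0 < norm (fst w) + norm (fst w') + 1"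
    by (simp add: add_nonneg_pos)
  have r: "0 < r" "10 * r \<le> d" "10 * r \<le> d'"
    unfolding r_def using d(1) d'(1) \<delta>(1) N by auto
  have "r \<le> \<delta> / (11 * (norm (fst w) + norm (fst w') + 1))" unfolding r_def by simp
  then have "r * (11 * (norm (fst w) + norm (fst w') + 1)) \<le> \<delta>"
    using N by (simp add: pos_le_divide_eq)
  moreover have "10 * r * (norm (fst w) + norm (fst w')) < r * (11 * (norm (fst w) + norm (fst w') + 1))"
    using r(1) by (simp add: algebra_simps add_nonneg_pos)
  ultimately have r\<delta>: "10 * r * (norm (fst w) + norm (fst w')) < \<delta>" by linarith
  have vert: "fst (v - u) = 0" "0 < snd (v - u)" using u by simp_all
  define d_over where "d_over = r *\<^sub>R w'"
  define d_under where "d_under = - r *\<^sub>R w"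
  have "fst (fst d_over) * snd (fst d_under) \<noteq> snd (fst d_over) * fst (fst d_under)"
    using det r(1) unfolding d_over_def d_under_def by simp
  then obtain X Y Z where "chart d_over d_under (v - u) X Y Z"
    using chart_exists[OF _ vert] by blast
  then interpret chart u d_over d_under "v - u" X Y Z .
  have uw: "u + s *\<^sub>R w = pt 0 (- s / r) 0" "v + s *\<^sub>R w' = pt (s / r) 0 1" for s
    unfolding pt_def dir_def unfolding d_over_def d_under_def using r(1) by simp_all
  have "crossing_chart u d_over d_under (v - u) X Y Z D"
  proof
    fix p assume p: "\<bar>cx p\<bar> < 10" "\<bar>cy p\<bar> < 10"
    show "p \<in> D \<longleftrightarrow> cx p = 0 \<and> cz p = 0 \<or> cy p = 0 \<and> cz p = 1"
    proof
      assume pD: "p \<in> D"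
      have "fst p = fst (pt (cx p) (cy p) (cz p))" by (simp only: pt_coordinates)
      also have "\<dots> = fst u + (cx p * r) *\<^sub>R fst w' - (cy p * r) *\<^sub>R fst w"
        unfolding pt_def dir_def unfolding d_over_def d_under_def using vert by simp
      finally have "dist (fst u) (fst p) = norm ((cx p * r) *\<^sub>R fst w' - (cy p * r) *\<^sub>R fst w)"
        by (simp add: dist_norm norm_minus_commute)
      also have "\<dots> \<le> norm ((cx p * r) *\<^sub>R fst w') + norm ((cy p * r) *\<^sub>R fst w)"
        by (rule norm_triangle_ineq4)
      also have "\<dots> \<le> 10 * r * norm (fst w') + 10 * r * norm (fst w)"
        using p r(1) by (intro add_mono) (simp_all add: abs_mult mult_right_mono)
      also have "\<dots> < \<delta>" using r\<delta> by (simp add: algebra_simps)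
      finally have "p \<in> V \<or> p \<in> V'" using \<delta>(2) pD by fastforce
      then show "cx p = 0 \<and> cz p = 0 \<or> cy p = 0 \<and> cz p = 1"
      proof
        assume "p \<in> V"
        then obtain s where "p = pt 0 (- s / r) 0" using V(3) pD uw by auto
        then show ?thesis by simp
      next
        assume "p \<in> V'"
        then obtain s where "p = pt (s / r) 0 1" using V'(4) pD uw by auto
        then show ?thesis by simp
      qed
    next
      assume "cx p = 0 \<and> cz p = 0 \<or> cy p = 0 \<and> cz p = 1"
      then show "p \<in> D"
      proof
        assume "cx p = 0 \<and> cz p = 0"
        then have "p = u + (- cy p * r) *\<^sub>R w"
          using pt_coordinates[of p] uw(1)[of "- cy p * r"] r(1) by simp
        moreover have "\<bar>- cy p * r\<bar> < d"
        proof -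
          have "\<bar>- cy p * r\<bar> = \<bar>cy p\<bar> * r" using r(1) by (simp add: abs_mult)
          then show ?thesis using mult_strict_right_mono[OF p(2) r(1)] r by linarith
        qed
        ultimately show ?thesis using uD[of "- cy p * r"] by simp
      next
        assume "cy p = 0 \<and> cz p = 1"
        then have eq: "p = v + (cx p * r) *\<^sub>R w'"
          using pt_coordinates[of p] uw(2)[of "cx p * r"] r(1) by simp
        have "\<bar>cx p * r\<bar> < d'"
        proof -
          have "\<bar>cx p * r\<bar> = \<bar>cx p\<bar> * r" using r(1) by (simp add: abs_mult)
          then show ?thesis using mult_strict_right_mono[OF p(1) r(1)] r by linarith
        qed
        then have "v + (cx p * r) *\<^sub>R w' \<in> D" by (rule vD)
        then show ?thesis by (rule ssubst[OF eq, of "\<lambda>q. q \<in> D"])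
      qed
    qed
  qed
  then show thesis by (rule that[OF r(1) d_under_def refl])
qed

context crossing_chart
begin


section \<open>The finger move\<close>

text \<open>The value of the function \<open>bump\<close> below on the upper strand: a tent over the interval from \<open>1\<close> to
  \<open>3\<close> with its top of height \<open>3\<close> at \<open>2\<close>.\<close>

definition dent :: "real \<Rightarrow> real" where
  "dent x = max 0 (3 - 3 * \<bar>x - 2\<bar>)"

text \<open>The move pushes points in the direction \<open>(- 1, 1, - 1)\<close>. The first two absolute values are constant in
  this direction, so only the last term, of slope \<open>1/2\<close>, matters for the Lipschitz condition of a
  shear. The first absolute value is at least \<open>1\<close> on the lower strand, which therefore stays fixed. The
  second one bounds the support in the remaining direction.\<close>

definition bump :: "space3 \<Rightarrow> real" where
  "bump p = max 0 (3 - 3 * \<bar>cx p - 1 - cz p\<bar> - \<bar>cy p - 1 + cz p\<bar> - \<bar>cz p - 1\<bar> / 2)"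

text \<open>The segment of the upper strand from \<open>(1, 0, 1)\<close> to \<open>(3, 0, 1)\<close> is replaced by the other two sides
  of the triangle with apex \<open>(- 1, 3, - 2)\<close>. These cross the vertical plane of the lower strand at
  \<open>(0, 3/2, - 1/2)\<close> and \<open>(0, 9/4, - 5/4)\<close>, beneath the lower strand.\<close>

definition push :: "space3 \<Rightarrow> space3" where
  "push p = p + bump p *\<^sub>R dir (- 1) 1 (- 1)"

lemma coordinates_push [simp]:
  "cx (push p) = cx p - bump p" "cy (push p) = cy p + bump p" "cz (push p) = cz p - bump p"
  unfolding push_def by simp_all

lemma continuous_bump: "continuous_on UNIV bump"
  unfolding bump_def by (intro continuous_intros) simp

lemma bump_lipschitz: "\<bar>bump (p + s *\<^sub>R dir (- 1) 1 (- 1)) - bump p\<bar> \<le> \<bar>s\<bar> / 2"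
proof -
  define k where "k = 3 - 3 * \<bar>cx p - 1 - cz p\<bar> - \<bar>cy p - 1 + cz p\<bar>"
  have "bump p = max 0 (k - \<bar>cz p - 1\<bar> / 2)"
    unfolding bump_def k_def ..
  moreover have "bump (p + s *\<^sub>R dir (- 1) 1 (- 1)) = max 0 (k - \<bar>cz p - s - 1\<bar> / 2)"
    unfolding bump_def k_def by (simp add: algebra_simps)
  moreover have "\<bar>max 0 a - max 0 b\<bar> \<le> \<bar>a - b\<bar>" for a b :: real
    by (simp add: max_def)
  moreover have "\<bar>(k - \<bar>cz p - s - 1\<bar> / 2) - (k - \<bar>cz p - 1\<bar> / 2)\<bar> \<le> \<bar>s\<bar> / 2"
    by (simp add: abs_if)
  ultimately show ?thesis by (metis order_trans)
qed

lemma push_homeomorphism: "\<exists>k. homeomorphism UNIV UNIV push k"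
  using shear_homeomorphism[OF continuous_bump bump_lipschitz] unfolding push_def .

lemma inj_push: "inj push"
  using push_homeomorphism unfolding homeomorphism_def by (metis injI iso_tuple_UNIV_I)

lemma ambient_isotopic_push: "ambient_isotopic D (push ` D)"
  using ambient_isotopic_shear[OF continuous_bump bump_lipschitz] unfolding push_def .

lemma piecewise_affine_bump: "piecewise_affine bump"
proof -
  have aff: "piecewise_affine cx" "piecewise_affine cy" "piecewise_affine cz"
    and const: "piecewise_affine (\<lambda>p::space3. c)" for c :: real
    by (auto intro!: piecewise_affine_affine affine_coordinates)
      (simp add: affine_on_segment_def algebra_simps)
  have mult: "piecewise_affine (\<lambda>p. f p * c)" if "piecewise_affine f" for f :: "space3 \<Rightarrow> real" and c
    using piecewise_affine_scaleR[OF that, of c] by simp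
  note sum = piecewise_affine_add
  have "piecewise_affine (\<lambda>p. 3 + \<bar>cx p + (- 1 + cz p * (- 1))\<bar> * (- 3)
      + \<bar>cy p + (- 1 + cz p)\<bar> * (- 1) + \<bar>cz p + (- 1)\<bar> * (- 1 / 2))" (is "piecewise_affine ?f")
    by (intro sum mult piecewise_affine_abs aff const)
  then have "piecewise_affine (\<lambda>p. ?f p * (1 / 2) + \<bar>?f p\<bar> * (1 / 2))"
    by (intro sum mult piecewise_affine_abs aff const)
  moreover have "(\<lambda>p. ?f p * (1 / 2) + \<bar>?f p\<bar> * (1 / 2)) = bump"
  proof
    fix p
    have "3 - 3 * \<bar>cx p - 1 - cz p\<bar> - \<bar>cy p - 1 + cz p\<bar> - \<bar>cz p - 1\<bar> / 2 = ?f p"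
    proof -
      have e: "cx p + (- 1 + cz p * (- 1)) = cx p - 1 - cz p" "cy p + (- 1 + cz p) = cy p - 1 + cz p"
        "cz p + (- 1) = cz p - 1"
        by simp_all
      have "3 - 3 * x - y - z / 2 = 3 + x * (- 3) + y * (- 1) + z * (- 1 / 2)" for x y z :: real
        by simp
      then show ?thesis unfolding e .
    qed
    moreover have "max 0 r = r * (1 / 2) + \<bar>r\<bar> * (1 / 2)" for r :: real
      by (simp add: max_def)
    ultimately show "?f p * (1 / 2) + \<bar>?f p\<bar> * (1 / 2) = bump p"
      unfolding bump_def by presburger
  qed
  ultimately show ?thesis by simp
qed

lemma piecewise_affine_push: "piecewise_affine push"
  unfolding push_def
  by (intro piecewise_affine_add piecewise_affine_scaleR piecewise_affine_bump piecewise_affine_affine)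
    (simp add: affine_on_segment_def)

lemma continuous_push: "continuous_on UNIV push"
  using push_homeomorphism unfolding homeomorphism_def by blast

definition inside :: "space3 \<Rightarrow> bool" where
  "inside p \<longleftrightarrow> \<bar>cx p\<bar> < 10 \<and> \<bar>cy p\<bar> < 10"

definition over_pt :: "real \<Rightarrow> space3" where "over_pt x = pt x 0 1"
definition under_pt :: "real \<Rightarrow> space3" where "under_pt y = pt 0 y 0"

lemma coordinates_strands [simp]:
  "cx (over_pt x) = x" "cy (over_pt x) = 0" "cz (over_pt x) = 1" "cx (under_pt y) = 0" "cy (under_pt y) = y" "cz (under_pt y) = 0"
  unfolding over_pt_def under_pt_def by simp_all

lemma strand_eq_iff [simp]: "over_pt x = over_pt x' \<longleftrightarrow> x = x'" "under_pt y = under_pt y' \<longleftrightarrow> y = y'" "over_pt x \<noteq> under_pt y" "under_pt y \<noteq> over_pt x"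
  unfolding over_pt_def under_pt_def by simp_all

lemma inside_strands [simp]: "inside (over_pt x) \<longleftrightarrow> \<bar>x\<bar> < 10" "inside (under_pt y) \<longleftrightarrow> \<bar>y\<bar> < 10"
  unfolding inside_def by simp_all

lemma over_pt_in_D: "\<bar>x\<bar> < 10 \<Longrightarrow> over_pt x \<in> D"
  by (subst near) simp_all

lemma under_pt_in_D: "\<bar>y\<bar> < 10 \<Longrightarrow> under_pt y \<in> D"
  by (subst near) simp_all

lemma inside_cases:
  assumes "q \<in> D" "inside q"
  obtains (over) x where "\<bar>x\<bar> < 10" "q = over_pt x" | (under) y where "\<bar>y\<bar> < 10" "q = under_pt y"
proof -
  have "cx q = 0 \<and> cz q = 0 \<or> cy q = 0 \<and> cz q = 1"
    using near[of q] assms unfolding inside_def by simp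
  then show thesis
  proof
    assume "cx q = 0 \<and> cz q = 0"
    then have "q = under_pt (cy q)" unfolding under_pt_def by (intro pt_eqI) simp_all
    then show thesis using under assms(2) unfolding inside_def by blast
  next
    assume "cy q = 0 \<and> cz q = 1"
    then have "q = over_pt (cx q)" unfolding over_pt_def by (intro pt_eqI) simp_all
    then show thesis using over assms(2) unfolding inside_def by blast
  qed
qed

lemma bump_over_pt [simp]: "bump (over_pt x) = dent x"
  unfolding bump_def dent_def by (simp add: max_def abs_if)

lemma bump_under_pt [simp]: "bump (under_pt y) = 0"
  unfolding bump_def by (simp add: max_def abs_if)

lemma bump_outside: "9 \<le> \<bar>cx p\<bar> \<or> 9 \<le> \<bar>cy p\<bar> \<Longrightarrow> bump p = 0"
proof -
  assume far: "9 \<le> \<bar>cx p\<bar> \<or> 9 \<le> \<bar>cy p\<bar>"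
  have "\<bar>cx p\<bar> \<le> \<bar>cx p - 1 - cz p\<bar> + \<bar>cz p - 1\<bar> + 2" by linarith
  moreover have "\<bar>cy p\<bar> \<le> \<bar>cy p - 1 + cz p\<bar> + \<bar>cz p - 1\<bar>" by linarith
  ultimately have "3 - 3 * \<bar>cx p - 1 - cz p\<bar> - \<bar>cy p - 1 + cz p\<bar> - \<bar>cz p - 1\<bar> / 2 \<le> 0"
    using far abs_ge_zero[of "cx p - 1 - cz p"] abs_ge_zero[of "cy p - 1 + cz p"] abs_ge_zero[of "cz p - 1"]
    by argo
  then show ?thesis unfolding bump_def by (rule max_absorb1)
qed

lemma push_fixed: "bump p = 0 \<Longrightarrow> push p = p"
  unfolding push_def by simp

lemma push_over_pt: "push (over_pt x) = pt (x - dent x) (dent x) (1 - dent x)"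
  by (intro pt_eqI) simp_all

lemma push_under_pt [simp]: "push (under_pt y) = under_pt y"
  by (simp add: push_fixed)

lemma push_not_inside: "\<not> inside p \<Longrightarrow> push p = p"
  unfolding inside_def by (intro push_fixed bump_outside) auto

lemma dent_bounds: "0 \<le> dent x" "dent x \<le> 3" "dent x = 0 \<or> 1 < x \<and> x < 3"
  unfolding dent_def by (auto simp: max_def abs_if split: if_splits)

lemma inside_push_iff: "q \<in> D \<Longrightarrow> inside (push q) \<longleftrightarrow> inside q"
proof (cases "inside q")
  case True
  assume "q \<in> D"
  then show ?thesis
    using True
  proof (cases rule: inside_cases)
    case (over x)
    then show ?thesis
      using dent_bounds[of x] True unfolding inside_def by (simp add: abs_if split: if_splits)
  qed simp
qed (simp add: push_not_inside)

lemma dent_fixed: "dent x = x \<Longrightarrow> x = 0 \<or> x = 3 / 2 \<or> x = 9 / 4"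
  unfolding dent_def by (auto simp: max_def abs_if split: if_splits)

lemma dent_values [simp]: "dent (3 / 2) = 3 / 2" "dent (9 / 4) = 9 / 4" "dent 0 = 0"
  unfolding dent_def by simp_all

text \<open>The two pairs of points that \<open>push\<close> places on a common vertical line; the first point of a pair
  becomes the lower one. The numbers
  \<open>3/2\<close> and \<open>9/4\<close> are the nonzero fixed points of \<open>dent\<close>, since \<open>push\<close> moves the point \<open>x\<close> of the upper
  strand to the first coordinate \<open>x - dent x\<close> and the second coordinate \<open>dent x\<close>.\<close>

definition new_pair :: "space3 \<Rightarrow> space3 \<Rightarrow> bool" where
  "new_pair q r \<longleftrightarrow> q = over_pt (3 / 2) \<and> r = under_pt (3 / 2) \<or> q = over_pt (9 / 4) \<and> r = under_pt (9 / 4)"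

lemma inside_fst_eq: "fst p = fst q \<Longrightarrow> inside p \<longleftrightarrow> inside q"
  unfolding inside_def fst_eq_iff by simp

lemma strands_push_fst_eq:
  "fst (push (over_pt x)) = fst (push (under_pt y)) \<longleftrightarrow> fst (over_pt x) = fst (under_pt y) \<or> new_pair (over_pt x) (under_pt y)"
proof -
  have "fst (push (over_pt x)) = fst (push (under_pt y)) \<longleftrightarrow> dent x = x \<and> y = dent x"
    unfolding fst_eq_iff by auto
  also have "\<dots> \<longleftrightarrow> x = 0 \<and> y = 0 \<or> x = 3 / 2 \<and> y = 3 / 2 \<or> x = 9 / 4 \<and> y = 9 / 4"
  proof
    assume "dent x = x \<and> y = dent x"
    then show "x = 0 \<and> y = 0 \<or> x = 3 / 2 \<and> y = 3 / 2 \<or> x = 9 / 4 \<and> y = 9 / 4"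
      using dent_fixed[of x] by simp
  qed (elim disjE conjE; hypsubst; simp)
  finally show ?thesis unfolding fst_eq_iff new_pair_def by auto
qed

text \<open>Outside the square nothing moves, and no point leaves or enters it. Inside, the upper strand stays
  injectively projected and the lower one is fixed, so that only intersections of the two strands have to
  be computed.\<close>

lemma push_fst_eq:
  assumes q: "q \<in> D" and r: "r \<in> D"
  shows "fst (push q) = fst (push r) \<longleftrightarrow> fst q = fst r \<or> new_pair q r \<or> new_pair r q"
proof (cases "inside q \<and> inside r")
  case True
  then have "inside q" "inside r" by simp_all
  then show ?thesis
  proof (cases rule: inside_cases[OF q \<open>inside q\<close>]; cases rule: inside_cases[OF r \<open>inside r\<close>])
    fix x y assume "q = over_pt x" "r = over_pt y"
    then show ?thesis unfolding fst_eq_iff new_pair_def by auto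
  next
    fix x y assume "q = over_pt x" "r = under_pt y"
    then show ?thesis using strands_push_fst_eq[of x y] unfolding new_pair_def by simp
  next
    fix x y assume "q = under_pt y" "r = over_pt x"
    moreover have "fst (push (under_pt y)) = fst (push (over_pt x)) \<longleftrightarrow> fst (under_pt y) = fst (over_pt x) \<or> new_pair (over_pt x) (under_pt y)"
      unfolding eq_commute[of "fst (push (under_pt y))"] eq_commute[of "fst (under_pt y)"] by (rule strands_push_fst_eq)
    ultimately show ?thesis unfolding new_pair_def by simp
  next
    fix x y assume "q = under_pt x" "r = under_pt y"
    then show ?thesis unfolding new_pair_def by simp
  qed
next
  case False
  then have "\<not> new_pair q r" "\<not> new_pair r q" unfolding new_pair_def by auto
  moreover have "fst (push q) = fst (push r) \<longleftrightarrow> fst q = fst r"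
  proof (cases "\<not> inside q \<and> \<not> inside r")
    case True
    then show ?thesis by (simp add: push_not_inside)
  next
    case False
    then have "inside q \<noteq> inside r" using \<open>\<not> (inside q \<and> inside r)\<close> by blast
    then show ?thesis
      using inside_fst_eq[of q r] inside_fst_eq[of "push q" "push r"] inside_push_iff q r by blast
  qed
  ultimately show ?thesis by blast
qed

lemma multiple_inside:
  assumes "q \<in> multiple_points D" "inside q"
  shows "q = over_pt 0 \<or> q = under_pt 0"
proof -
  obtain r where r: "r \<in> D" "r \<noteq> q" "fst r = fst q" and q: "q \<in> D"
    using assms unfolding multiple_points_def by blast
  have "inside r" using inside_fst_eq[OF r(3)] assms(2) by simp
  show ?thesis
    using r(2,3)
    by (cases rule: inside_cases[OF q assms(2)]; cases rule: inside_cases[OF r(1) \<open>inside r\<close>])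
      (simp_all add: fst_eq_iff)
qed

text \<open>A neighborhood is required, so that straightness and colors near the point are inherited.\<close>

definition unmoved :: "space3 \<Rightarrow> bool" where
  "unmoved q \<longleftrightarrow> (\<exists>V. open V \<and> q \<in> V \<and> (\<forall>p\<in>V. bump p = 0))"

lemma unmovedD: "unmoved q \<Longrightarrow> bump q = 0"
  unfolding unmoved_def by blast

lemma unmoved_outside: "\<not> inside q \<Longrightarrow> unmoved q"
proof -
  assume "\<not> inside q"
  then have "q \<in> {p. 9 < \<bar>cx p\<bar>} \<union> {p. 9 < \<bar>cy p\<bar>}" unfolding inside_def by auto
  moreover have "open ({p. 9 < \<bar>cx p\<bar>} \<union> {p. 9 < \<bar>cy p\<bar>})"
    by (intro open_Un open_Collect_less continuous_intros)
  ultimately show ?thesis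
    unfolding unmoved_def using bump_outside by (metis (mono_tags, lifting) Un_iff less_imp_le mem_Collect_eq)
qed

lemma unmovedI:
  assumes "3 < 3 * \<bar>cx q - 1 - cz q\<bar> + \<bar>cz q - 1\<bar> / 2"
  shows "unmoved q"
proof -
  let ?V = "{p. 3 < 3 * \<bar>cx p - 1 - cz p\<bar> + \<bar>cz p - 1\<bar> / 2}"
  have "open ?V" by (intro open_Collect_less continuous_intros) simp
  moreover have "bump p = 0" if "p \<in> ?V" for p
  proof -
    have "3 - 3 * \<bar>cx p - 1 - cz p\<bar> - \<bar>cy p - 1 + cz p\<bar> - \<bar>cz p - 1\<bar> / 2 \<le> 0"
      using that abs_ge_zero[of "cy p - 1 + cz p"] unfolding mem_Collect_eq by argo
    then show ?thesis unfolding bump_def by (rule max_absorb1)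
  qed
  ultimately show ?thesis
    unfolding unmoved_def using assms by blast
qed

lemma unmoved_under_pt: "unmoved (under_pt y)"
  by (rule unmovedI) simp

lemma unmoved_multiple: "q \<in> multiple_points D \<Longrightarrow> unmoved q"
  using multiple_inside unmoved_outside unmoved_under_pt unmovedI[of "over_pt 0"] by fastforce

lemma straight_at_unmoved:
  assumes "straight_at D q" "unmoved q"
  shows "straight_at (push ` D) q"
proof -
  obtain w V where V: "w \<noteq> 0" "open V" "q \<in> V" "\<forall>p\<in>V. p \<in> D \<longleftrightarrow> (\<exists>s. p = q + s *\<^sub>R w)"
    using assms(1) unfolding straight_at_iff by blast
  obtain V' where V': "open V'" "q \<in> V'" "\<forall>p\<in>V'. bump p = 0"
    using assms(2) unfolding unmoved_def by blast
  have "p \<in> push ` D \<longleftrightarrow> p \<in> D" if "p \<in> V'" for p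
    using push_fixed[of p] V'(3) that inj_push by (metis inj_image_mem_iff)
  then have "\<forall>p\<in>V \<inter> V'. p \<in> push ` D \<longleftrightarrow> (\<exists>s. p = q + s *\<^sub>R w)"
    using V(4) by blast
  then show ?thesis
    unfolding straight_at_iff using V(1-3) V'(1,2)
    by (intro exI[of _ w] exI[of _ "V \<inter> V'"]) auto
qed

lemma straight_at_under_pt:
  assumes "0 < \<bar>y\<bar>" "\<bar>y\<bar> < 10"
  shows "straight_at D (under_pt y)"
proof -
  let ?V = "{p. \<bar>cx p\<bar> < 10} \<inter> {p. \<bar>cy p\<bar> < 10} \<inter> {p. cz p < 1}"
  have "open ?V" by (intro open_Int open_Collect_less continuous_intros)
  moreover have "under_pt y \<in> ?V" using assms by simp
  moreover have "p \<in> D \<longleftrightarrow> (\<exists>s. p = under_pt y + s *\<^sub>R dir 0 1 0)" if "p \<in> ?V" for p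
  proof -
    have "p \<in> D \<longleftrightarrow> cx p = 0 \<and> cz p = 0" using near[of p] that by auto
    also have "\<dots> \<longleftrightarrow> p = under_pt y + (cy p - y) *\<^sub>R dir 0 1 0"
    proof
      assume "cx p = 0 \<and> cz p = 0"
      then show "p = under_pt y + (cy p - y) *\<^sub>R dir 0 1 0"
        unfolding under_pt_def pt_add by (intro pt_eqI) simp_all
    next
      assume "p = under_pt y + (cy p - y) *\<^sub>R dir 0 1 0"
      then have "p = pt 0 (cy p) 0" unfolding under_pt_def pt_add by simp
      then show "cx p = 0 \<and> cz p = 0" using coordinates_pt by metis
    qed
    also have "\<dots> \<longleftrightarrow> (\<exists>s. p = under_pt y + s *\<^sub>R dir 0 1 0)"
    proof
      assume "\<exists>s. p = under_pt y + s *\<^sub>R dir 0 1 0"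
      then obtain s where "p = pt 0 (y + s) 0" unfolding under_pt_def pt_add by auto
      then show "p = under_pt y + (cy p - y) *\<^sub>R dir 0 1 0" unfolding under_pt_def pt_add by simp
    qed blast
    finally show ?thesis .
  qed
  ultimately show ?thesis
    unfolding straight_at_iff using dir_nonzero[of 0 1 0]
    by (intro exI[of _ "dir 0 1 0"] exI[of _ ?V]) simp
qed

lemma dent_affine:
  "\<bar>s\<bar> \<le> 1 / 2 \<Longrightarrow> dent (3 / 2 + s) = 3 / 2 + 3 * s"
  "\<bar>s\<bar> \<le> 1 / 4 \<Longrightarrow> dent (9 / 4 + s) = 9 / 4 - 3 * s"
  unfolding dent_def by (auto simp: max_def abs_if split: if_splits)

lemma push_over_pt_affine:
  "\<bar>s\<bar> \<le> 1 / 2 \<Longrightarrow> push (over_pt (3 / 2 + s)) = push (over_pt (3 / 2)) + s *\<^sub>R dir (- 2) 3 (- 3)"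
  "\<bar>s\<bar> \<le> 1 / 4 \<Longrightarrow> push (over_pt (9 / 4 + s)) = push (over_pt (9 / 4)) + s *\<^sub>R dir 4 (- 3) 3"
  unfolding push_over_pt pt_add by (simp_all add: dent_affine)

text \<open>Away from its corners the finger is straight: near \<open>over_pt t\<close> only the upper strand is met, and
  \<open>push\<close> is affine along it. The bound on the second coordinate, which has slope \<open>b\<close>, cuts the
  line down to the segment on which this affine description is valid.\<close>

lemma straight_at_push_over_pt:
  assumes t: "\<bar>t\<bar> < 9" and e: "0 < e" "e \<le> 1" and b: "b \<noteq> 0"
    and aff: "\<And>s. \<bar>s\<bar> \<le> e \<Longrightarrow> push (over_pt (t + s)) = push (over_pt t) + s *\<^sub>R dir a b c"
  shows "straight_at (push ` D) (push (over_pt t))"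
proof -
  obtain k where k: "homeomorphism UNIV UNIV push k" using push_homeomorphism by blast
  have kp: "k (push p) = p" "push (k p) = p" for p
    using homeomorphism_apply1[OF k] homeomorphism_apply2[OF k] by simp_all
  let ?O = "{p. \<bar>cx p - t\<bar> < e} \<inter> {p. \<bar>cy p\<bar> < 10} \<inter> {p. 0 < cz p}"
  let ?V = "k -` ?O \<inter> {p. \<bar>cy p - cy (push (over_pt t))\<bar> < e * \<bar>b\<bar>}"
  have "open (k -` ?O)"
    using homeomorphism_cont2[OF k]
    by (intro open_vimage open_Int open_Collect_less continuous_intros)
  then have "open ?V"
    by (rule open_Int) (intro open_Collect_less continuous_intros)
  moreover have "push (over_pt t) \<in> ?V" using e b by (simp add: kp)
  moreover have "p \<in> push ` D \<longleftrightarrow> (\<exists>s. p = push (over_pt t) + s *\<^sub>R dir a b c)" if p: "p \<in> ?V" for p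
  proof
    assume "p \<in> push ` D"
    then have kD: "k p \<in> D" using kp by auto
    have kO: "k p \<in> ?O" using p by simp
    then have "inside (k p)" using t e unfolding inside_def by auto
    then have "k p = over_pt (cx (k p))"
      by (rule inside_cases[OF kD]) (use kO in auto)
    then have "p = push (over_pt (t + (cx (k p) - t)))" using kp by simp
    also have "\<dots> = push (over_pt t) + (cx (k p) - t) *\<^sub>R dir a b c"
      using kO by (intro aff) simp
    finally show "\<exists>s. p = push (over_pt t) + s *\<^sub>R dir a b c" by blast
  next
    assume "\<exists>s. p = push (over_pt t) + s *\<^sub>R dir a b c"
    then obtain s where s: "p = push (over_pt t) + s *\<^sub>R dir a b c" by blast
    then have "cy p = cy (push (over_pt t)) + s * b" by (simp only: coordinates_add)
    then have "\<bar>s\<bar> * \<bar>b\<bar> < e * \<bar>b\<bar>" using p by (simp add: abs_mult)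
    then have "\<bar>s\<bar> < e" using b by simp
    then have "p = push (over_pt (t + s))" using s aff by simp
    moreover have "over_pt (t + s) \<in> D" using t e \<open>\<bar>s\<bar> < e\<close> by (intro over_pt_in_D) linarith
    ultimately show "p \<in> push ` D" by blast
  qed
  ultimately show ?thesis
    unfolding straight_at_iff using dir_nonzero[of a b c] b
    by (intro exI[of _ "dir a b c"] exI[of _ ?V]) simp
qed

lemma new_pair_not_multiple:
  assumes "new_pair q r" "z \<in> D"
  shows "fst z = fst q \<longleftrightarrow> z = q" "fst z = fst r \<longleftrightarrow> z = r"
proof -
  have in_D: "q \<in> D" "r \<in> D" "inside q" "inside r"
    using assms(1) unfolding new_pair_def by (auto intro: over_pt_in_D under_pt_in_D)
  then have "q \<notin> multiple_points D" "r \<notin> multiple_points D"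
    using multiple_inside assms(1) unfolding new_pair_def by fastforce+
  then show "fst z = fst q \<longleftrightarrow> z = q" "fst z = fst r \<longleftrightarrow> z = r"
    using in_D assms(2) unfolding multiple_points_def by auto
qed

lemma new_pair_unique:
  "new_pair a b \<Longrightarrow> new_pair a c \<Longrightarrow> c = b"
  "new_pair b a \<Longrightarrow> new_pair c a \<Longrightarrow> c = b"
  "new_pair a b \<Longrightarrow> \<not> new_pair c a"
  unfolding new_pair_def by (elim disjE conjE; simp)+

lemma new_pair_in_D: "new_pair q r \<Longrightarrow> q \<in> D \<and> r \<in> D"
  unfolding new_pair_def by (auto intro: over_pt_in_D under_pt_in_D)

lemma multiple_points_push:
  "multiple_points (push ` D) = push ` (multiple_points D \<union> {q. \<exists>r. new_pair q r \<or> new_pair r q})"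
proof (rule set_eqI, rule iffI)
  fix p assume "p \<in> multiple_points (push ` D)"
  then obtain q r where q: "q \<in> D" "p = push q" and r: "r \<in> D" "push r \<noteq> push q" "fst (push r) = fst (push q)"
    unfolding multiple_points_def by blast
  then have "r \<noteq> q" "fst r = fst q \<or> new_pair r q \<or> new_pair q r"
    using push_fst_eq by auto
  then have "q \<in> multiple_points D \<union> {q. \<exists>r. new_pair q r \<or> new_pair r q}"
    using q(1) r(1) unfolding multiple_points_def by blast
  then show "p \<in> push ` (multiple_points D \<union> {q. \<exists>r. new_pair q r \<or> new_pair r q})"
    using q(2) by blast
next
  fix p assume "p \<in> push ` (multiple_points D \<union> {q. \<exists>r. new_pair q r \<or> new_pair r q})"
  then obtain q where q: "p = push q" "q \<in> multiple_points D \<or> (\<exists>r. new_pair q r \<or> new_pair r q)"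
    by blast
  obtain r where r: "q \<in> D" "r \<in> D" "r \<noteq> q" "fst r = fst q \<or> new_pair q r \<or> new_pair r q"
  proof (cases "q \<in> multiple_points D")
    case True
    then show ?thesis using that unfolding multiple_points_def by blast
  next
    case False
    then obtain r where r: "new_pair q r \<or> new_pair r q" using q(2) by blast
    then have "r \<noteq> q" unfolding new_pair_def by auto
    then show ?thesis using that r new_pair_in_D by blast
  qed
  then have "fst (push r) = fst (push q)" using push_fst_eq by blast
  moreover have "push r \<noteq> push q" using r(3) inj_push by (simp add: inj_eq)
  ultimately show "p \<in> multiple_points (push ` D)"
    using r(1,2) q(1) unfolding multiple_points_def by blast
qed

lemma new_points: "{q. \<exists>r. new_pair q r \<or> new_pair r q} = {over_pt (3 / 2), under_pt (3 / 2), over_pt (9 / 4), under_pt (9 / 4)}"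
  unfolding new_pair_def by blast

text \<open>Old multiple points do not move, and the new ones lie on straight parts of both strands. A triple point
  would involve a new pair, but the members of a new pair are alone on their vertical lines before the
  move.\<close>

lemma regular_projection_push:
  assumes D: "regular_projection D"
  shows "regular_projection (push ` D)"
  unfolding regular_projection_def
proof (intro conjI ballI impI)
  show "finite (multiple_points (push ` D))"
    using D unfolding multiple_points_push new_points regular_projection_def by simp
  show "straight_at (push ` D) p" if p: "p \<in> multiple_points (push ` D)" for p
  proof -
    have "straight_at (push ` D) (push q)" if q: "q \<in> multiple_points D" for q
      using straight_at_unmoved[of q] D unmoved_multiple[OF q] q push_fixed unmovedD
      unfolding regular_projection_def by metis
    moreover have "straight_at (push ` D) (push (over_pt (3 / 2)))"
      by (rule straight_at_push_over_pt[where e = "1 / 2", OF _ _ _ _ push_over_pt_affine(1)]) simp_all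
    moreover have "straight_at (push ` D) (push (over_pt (9 / 4)))"
      by (rule straight_at_push_over_pt[where e = "1 / 4", OF _ _ _ _ push_over_pt_affine(2)]) simp_all
    moreover have "straight_at (push ` D) (push (under_pt y))" if "0 < \<bar>y\<bar>" "\<bar>y\<bar> < 10" for y
      using straight_at_unmoved[OF straight_at_under_pt unmoved_under_pt] that by simp
    ultimately show ?thesis
      using p unfolding multiple_points_push new_points by auto
  qed
  fix x y z assume "x \<in> push ` D" "y \<in> push ` D" "z \<in> push ` D"
    and eq: "fst x = fst y \<and> fst y = fst z"
  then obtain q r t where qrt: "q \<in> D" "x = push q" "r \<in> D" "y = push r" "t \<in> D" "z = push t"
    by blast
  have E: "fst q = fst r \<or> new_pair q r \<or> new_pair r q" "fst r = fst t \<or> new_pair r t \<or> new_pair t r"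
    "fst q = fst t \<or> new_pair q t \<or> new_pair t q"
    using eq[unfolded qrt(2,4,6)] push_fst_eq[OF qrt(1,3)] push_fst_eq[OF qrt(3,5)] push_fst_eq[OF qrt(1,5)]
    by simp_all
  have "q = r \<or> r = t \<or> q = t"
  proof (cases "fst q = fst r \<and> fst r = fst t")
    case True
    then show ?thesis using D qrt unfolding regular_projection_def by blast
  next
    case False
    have unique: "c = a \<or> c = b"
      if "new_pair a b \<or> new_pair b a" "c \<in> D" "fst a = fst c \<or> new_pair a c \<or> new_pair c a" for a b c
    proof (cases "fst a = fst c")
      case True
      then have "c = a" using that(1,2) new_pair_not_multiple(1)[of a b c] new_pair_not_multiple(2)[of b a c] by auto
      then show ?thesis ..
    next
      case False
      then have "new_pair a c \<or> new_pair c a" using that(3) by blast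
      then show ?thesis using that(1) new_pair_unique by blast
    qed
    show ?thesis
    proof (cases "new_pair q r \<or> new_pair r q")
      case True
      then show ?thesis using unique[OF True qrt(5) E(3)] by auto
    next
      case F2: False
      then have np: "new_pair r t \<or> new_pair t r" using False E(1,2) by blast
      have "fst r = fst q \<or> new_pair r q \<or> new_pair q r" using E(1) by auto
      then show ?thesis using unique[OF np qrt(1)] by auto
    qed
  qed
  then show "x = y \<or> y = z \<or> x = z" using qrt by blast
qed

text \<open>At an old crossing both points stay where they are. At a new one the heights are explicit.\<close>

lemma undercrossing_push:
  assumes q: "q \<in> D" and r: "r \<in> D"
  shows "undercrossing (push ` D) (push q) (push r) \<longleftrightarrow> undercrossing D q r \<or> new_pair q r"
proof (cases "fst q = fst r")
  case True
  then have "\<not> new_pair q r" unfolding new_pair_def fst_eq_iff by auto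
  moreover have "undercrossing (push ` D) (push q) (push r) \<longleftrightarrow> undercrossing D q r"
  proof (cases "q = r")
    case False
    then have "q \<in> multiple_points D" "r \<in> multiple_points D"
      using True q r unfolding multiple_points_def by auto
    then have "push q = q" "push r = r"
      using unmoved_multiple unmovedD push_fixed by auto
    moreover from this have "q \<in> push ` D" "r \<in> push ` D" using q r by (metis imageI)+
    ultimately show ?thesis using q r unfolding undercrossing_def by simp
  qed (simp add: undercrossing_def)
  ultimately show ?thesis by blast
next
  case False
  then have no: "\<not> undercrossing D q r" unfolding undercrossing_def by blast
  show ?thesis
  proof
    assume L: "undercrossing (push ` D) (push q) (push r)"
    then have "fst (push q) = fst (push r)" unfolding undercrossing_def by blast
    moreover from this have "cz (push q) < cz (push r)"
      using L snd_less_iff unfolding undercrossing_def by blast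
    ultimately have "new_pair q r \<or> new_pair r q \<and> cz (push q) < cz (push r)"
      using push_fst_eq[OF q r] False by blast
    then show "undercrossing D q r \<or> new_pair q r" unfolding new_pair_def by auto
  next
    assume "undercrossing D q r \<or> new_pair q r"
    then have np: "new_pair q r" using no by blast
    then have eq: "fst (push q) = fst (push r)" using push_fst_eq[OF q r] by blast
    have "cz (push q) < cz (push r)" using np unfolding new_pair_def by auto
    then show "undercrossing (push ` D) (push q) (push r)"
      using eq snd_less_iff[OF eq] q r unfolding undercrossing_def by blast
  qed
qed

text \<open>The move cuts the upper strand at the preimages of the two new undercrossings.\<close>

lemma over_points_push: "over_points (push ` D) = push ` (over_points D - {over_pt (3 / 2), over_pt (9 / 4)})"
proof -
  have "push q \<in> undercrossings (push ` D) \<longleftrightarrow> q \<in> undercrossings D \<or> q \<in> {over_pt (3 / 2), over_pt (9 / 4)}"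
    if q: "q \<in> D" for q
  proof -
    have "push q \<in> undercrossings (push ` D) \<longleftrightarrow> (\<exists>r\<in>D. undercrossing (push ` D) (push q) (push r))"
      unfolding undercrossings_def undercrossing_def by blast
    also have "\<dots> \<longleftrightarrow> (\<exists>r\<in>D. undercrossing D q r \<or> new_pair q r)"
      using undercrossing_push[OF q] by blast
    also have "\<dots> \<longleftrightarrow> q \<in> undercrossings D \<or> (\<exists>r. new_pair q r)"
      using new_pair_in_D unfolding undercrossings_def undercrossing_def by blast
    also have "(\<exists>r. new_pair q r) \<longleftrightarrow> q \<in> {over_pt (3 / 2), over_pt (9 / 4)}"
      unfolding new_pair_def by blast
    finally show ?thesis .
  qed
  then show ?thesis by blast
qed

end


section \<open>Coloring the finger\<close>

lemma point_coloring_constant: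
  assumes "point_coloring p D \<kappa>" "connected S" "S \<subseteq> over_points D" "x \<in> S" "y \<in> S"
  shows "\<kappa> x = \<kappa> y"
proof -
  have "\<kappa> constant_on S" using assms(1-3) unfolding point_coloring_def by blast
  then show ?thesis using assms(4,5) unfolding constant_on_def by auto
qed

context crossing_chart
begin

text \<open>The part of the upper strand that becomes the tip of the finger, between the new undercrossings.\<close>

definition middle :: "space3 set" where
  "middle = over_pt ` {3 / 2<..<9 / 4}"

definition recolor :: "(space3 \<Rightarrow> int) \<Rightarrow> int \<Rightarrow> space3 \<Rightarrow> int" where
  "recolor \<kappa> m p = (if inv push p \<in> middle then m else \<kappa> (inv push p))"

lemma recolor_push [simp]: "recolor \<kappa> m (push q) = (if q \<in> middle then m else \<kappa> q)"
  unfolding recolor_def by (simp add: inv_f_f[OF inj_push])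

text \<open>\<open>bump\<close> is positive on the closed middle part.\<close>

lemma recolor_unmoved:
  assumes "bump q = 0"
  shows "q \<notin> middle" "q \<noteq> over_pt (3 / 2)" "q \<noteq> over_pt (9 / 4)" "recolor \<kappa> m q = \<kappa> q"
proof -
  have "dent x > 0" if "3 / 2 \<le> x" "x \<le> 9 / 4" for x
    using that unfolding dent_def by (simp add: max_def abs_if)
  then have "q \<noteq> over_pt x" if "3 / 2 \<le> x" "x \<le> 9 / 4" for x
    using assms that by fastforce
  then show m: "q \<notin> middle" and "q \<noteq> over_pt (3 / 2)" "q \<noteq> over_pt (9 / 4)"
    unfolding middle_def by (simp_all add: image_iff)
  have "recolor \<kappa> m (push q) = \<kappa> q" using m by simp
  then show "recolor \<kappa> m q = \<kappa> q" using push_fixed[OF assms] by simp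
qed

lemma over_pt_over_point: "\<bar>x\<bar> < 10 \<Longrightarrow> over_pt x \<in> over_points D"
proof -
  assume x: "\<bar>x\<bar> < 10"
  have False if vx: "undercrossing D (over_pt x) v" for v
  proof -
    have v: "v \<in> D" "fst (over_pt x) = fst v" "snd (over_pt x) < snd v"
      using vx unfolding undercrossing_def by auto
    have "inside v" using inside_fst_eq[OF v(2)] x by simp
    have "cz (over_pt x) < cz v" using snd_less_iff[OF v(2)] v(3) by blast
    then show False
      by (cases rule: inside_cases[OF v(1) \<open>inside v\<close>]) simp_all
  qed
  then show ?thesis using over_pt_in_D[OF x] unfolding undercrossings_def by blast
qed

lemma under_pt_over_point: "y \<noteq> 0 \<Longrightarrow> \<bar>y\<bar> < 10 \<Longrightarrow> under_pt y \<in> over_points D"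
proof -
  assume y: "y \<noteq> 0" "\<bar>y\<bar> < 10"
  have False if vy: "undercrossing D (under_pt y) v" for v
  proof -
    have v: "v \<in> D" "fst (under_pt y) = fst v" "snd (under_pt y) < snd v"
      using vy unfolding undercrossing_def by auto
    have "inside v" using inside_fst_eq[OF v(2)] y by simp
    have "cz (under_pt y) < cz v" using snd_less_iff[OF v(2)] v(3) by blast
    then show False
      using v(2) y(1) unfolding fst_eq_iff
      by (cases rule: inside_cases[OF v(1) \<open>inside v\<close>]) simp_all
  qed
  then show ?thesis using under_pt_in_D[OF y(2)] unfolding undercrossings_def by blast
qed

lemma connected_strands: "connected (over_pt ` {a<..<b})" "connected (under_pt ` {a<..<b})"
proof -
  have A: "over_pt = (\<lambda>x. over_pt 0 + x *\<^sub>R dir 1 0 0)" and W: "under_pt = (\<lambda>x. under_pt 0 + x *\<^sub>R dir 0 1 0)"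
    unfolding over_pt_def under_pt_def pt_add by (rule ext, simp)+
  have "continuous_on {a<..<b} over_pt" by (subst A) (intro continuous_intros)
  moreover have "continuous_on {a<..<b} under_pt" by (subst W) (intro continuous_intros)
  ultimately show "connected (over_pt ` {a<..<b})" "connected (under_pt ` {a<..<b})"
    by (auto intro!: connected_continuous_image)
qed

lemma color_over_pt:
  assumes "point_coloring p D \<kappa>" "\<bar>x\<bar> < 10"
  shows "\<kappa> (over_pt x) = \<kappa> (over_pt 0)"
proof (rule point_coloring_constant[OF assms(1) connected_strands(1)[of "- 10" 10]])
  show "over_pt ` {- 10<..<10} \<subseteq> over_points D"
    by (intro image_subsetI over_pt_over_point) auto
qed (use assms(2-) in \<open>auto intro!: imageI\<close>)

lemma color_under_pt:
  assumes "point_coloring p D \<kappa>" "0 < y" "y < 10"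
  shows "\<kappa> (under_pt y) = \<kappa> (under_pt 1)"
proof (rule point_coloring_constant[OF assms(1) connected_strands(2)[of "0" 10]])
  show "under_pt ` {0<..<10} \<subseteq> over_points D"
    by (intro image_subsetI under_pt_over_point) auto
qed (use assms(2-) in \<open>auto intro!: imageI\<close>)

text \<open>Once the strand is cut at both ends of the middle part, this part is relatively open and closed, so
  that recoloring it keeps the color constant on connected sets.\<close>

lemma middle_clopen:
  assumes "connected S" "S \<subseteq> D - {over_pt (3 / 2), over_pt (9 / 4)}"
  shows "S \<subseteq> middle \<or> S \<inter> middle = {}"
proof -
  let ?P = "{p. 3 / 2 < cx p} \<inter> {p. cx p < 9 / 4} \<inter> {p. \<bar>cy p\<bar> < 10} \<inter> {p. 0 < cz p}"
  let ?Q = "- ({p. 3 / 2 \<le> cx p} \<inter> {p. cx p \<le> 9 / 4} \<inter> {p. cy p = 0} \<inter> {p. cz p = 1})"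
  have P: "p \<in> ?P \<longleftrightarrow> p \<in> middle" if "p \<in> D" for p
  proof
    assume p: "p \<in> ?P"
    then have "inside p" unfolding inside_def by auto
    then show "p \<in> middle"
      by (rule inside_cases[OF that]) (use p in \<open>auto simp: middle_def\<close>)
  qed (auto simp: middle_def)
  have Q: "p \<in> ?Q \<longleftrightarrow> p \<notin> middle" if p: "p \<in> D - {over_pt (3 / 2), over_pt (9 / 4)}" for p
  proof
    assume "p \<notin> middle"
    show "p \<in> ?Q"
    proof (rule ccontr)
      assume "p \<notin> ?Q"
      then have c: "3 / 2 \<le> cx p" "cx p \<le> 9 / 4" "cy p = 0" "cz p = 1" by auto
      then have pA: "p = over_pt (cx p)" unfolding over_pt_def by (intro pt_eqI) simp_all
      have "cx p \<noteq> 3 / 2"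
      proof
        assume "cx p = 3 / 2"
        then have "p = over_pt (3 / 2)" using pA by metis
        then show False using p by blast
      qed
      moreover have "cx p \<noteq> 9 / 4"
      proof
        assume "cx p = 9 / 4"
        then have "p = over_pt (9 / 4)" using pA by metis
        then show False using p by blast
      qed
      ultimately show False using pA using \<open>p \<notin> middle\<close> c unfolding middle_def by force
    qed
  qed (auto simp: middle_def)
  have oP: "open ?P"
    by (intro open_Int open_Collect_less continuous_intros)
  have oQ: "open ?Q"
    by (intro open_Compl closed_Int closed_Collect_le closed_Collect_eq continuous_intros)
  have cover: "S \<subseteq> ?P \<union> ?Q"
  proof
    fix p assume "p \<in> S"
    then have "p \<in> D" "p \<in> D - {over_pt (3 / 2), over_pt (9 / 4)}" using assms(2) by blast+
    then show "p \<in> ?P \<union> ?Q" using P[of p] Q[of p] by (cases "p \<in> middle") simp_all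
  qed
  have disjoint: "?P \<inter> ?Q \<inter> S = {}"
  proof (rule equals0I)
    fix p assume p: "p \<in> ?P \<inter> ?Q \<inter> S"
    then have "p \<in> D" "p \<in> D - {over_pt (3 / 2), over_pt (9 / 4)}" using assms(2) by blast+
    then show False using P[of p] Q[of p] p by blast
  qed
  have "?P \<inter> S = {} \<or> ?Q \<inter> S = {}"
    by (rule connectedD[OF assms(1) oP oQ disjoint cover])
  then show ?thesis
  proof
    assume "?P \<inter> S = {}"
    then have "p \<notin> middle" if "p \<in> S" for p using P[of p] assms(2) that by blast
    then show ?thesis by blast
  next
    assume "?Q \<inter> S = {}"
    then have "p \<in> middle" if "p \<in> S" for p using Q[of p] assms(2) that by blast
    then show ?thesis by blast
  qed
qed

lemma side_colors_unmoved:
  assumes sc: "side_colors p D \<kappa> q w a c" and "unmoved q"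
  shows "side_colors p (push ` D) (recolor \<kappa> m) q w a c"
proof -
  obtain V where V: "open V" "q \<in> V" "\<forall>p\<in>V. bump p = 0"
    using assms(2) unfolding unmoved_def by blast
  obtain d where d: "0 < d" "\<And>s. \<bar>s\<bar> < d \<Longrightarrow> q + s *\<^sub>R w \<in> V"
    using line_in_open[OF V(1,2)] by metis
  obtain e where e: "0 < e" "\<And>s. 0 < s \<Longrightarrow> s < e \<Longrightarrow>
      q + s *\<^sub>R w \<in> over_points D \<and> q - s *\<^sub>R w \<in> over_points D \<and>
      [\<kappa> (q + s *\<^sub>R w) = a] (mod int p) \<and> [\<kappa> (q - s *\<^sub>R w) = c] (mod int p)"
    using sc unfolding side_colors_def by blast
  have keep: "x \<in> over_points (push ` D)" if "x \<in> V" "x \<in> over_points D" for x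
  proof -
    have b: "bump x = 0" using V(3) that(1) by blast
    then have "x \<in> over_points D - {over_pt (3 / 2), over_pt (9 / 4)}"
      using recolor_unmoved(2,3)[OF b] that(2) by blast
    then have "push x \<in> over_points (push ` D)" unfolding over_points_push by blast
    then show ?thesis using push_fixed[OF b] by simp
  qed
  show ?thesis
    unfolding side_colors_def
  proof (intro exI[of _ "min d e"] conjI allI impI)
    show "0 < min d e" using d(1) e(1) by simp
    fix s assume s: "0 < s \<and> s < min d e"
    then have V': "q + s *\<^sub>R w \<in> V" "q - s *\<^sub>R w \<in> V" using d(2)[of s] d(2)[of "- s"] by auto
    have rc: "recolor \<kappa> m (q + s *\<^sub>R w) = \<kappa> (q + s *\<^sub>R w)" "recolor \<kappa> m (q - s *\<^sub>R w) = \<kappa> (q - s *\<^sub>R w)"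
      using V' V(3) recolor_unmoved(4) by blast+
    have es: "q + s *\<^sub>R w \<in> over_points D" "q - s *\<^sub>R w \<in> over_points D"
      "[\<kappa> (q + s *\<^sub>R w) = a] (mod int p)" "[\<kappa> (q - s *\<^sub>R w) = c] (mod int p)"
      using e(2)[of s] s by auto
    show "q + s *\<^sub>R w \<in> over_points (push ` D)" "q - s *\<^sub>R w \<in> over_points (push ` D)"
      by (rule keep[OF V'(1) es(1)], rule keep[OF V'(2) es(2)])
    show "[recolor \<kappa> m (q + s *\<^sub>R w) = a] (mod int p)" "[recolor \<kappa> m (q - s *\<^sub>R w) = c] (mod int p)"
      unfolding rc by (rule es(3), rule es(4))
  qed
qed

lemma push_over_pt_over_point:
  assumes "\<bar>x\<bar> < 10" "x \<noteq> 3 / 2" "x \<noteq> 9 / 4"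
  shows "push (over_pt x) \<in> over_points (push ` D)"
proof -
  have "over_pt x \<in> over_points D - {over_pt (3 / 2), over_pt (9 / 4)}"
    using over_pt_over_point[OF assms(1)] assms(2,3) by simp
  then show ?thesis unfolding over_points_push by blast
qed

lemma middle_over_pt [simp]: "over_pt x \<in> middle \<longleftrightarrow> 3 / 2 < x \<and> x < 9 / 4"
  unfolding middle_def by auto

lemma middle_under_pt [simp]: "under_pt y \<notin> middle"
  unfolding middle_def by auto

text \<open>The directions are the derivatives of \<open>push\<close> along the upper strand at the two points, so the tip of
  the finger lies ahead at the first new undercrossing and behind at the second one.\<close>

lemma side_colors_new:
  assumes \<kappa>: "point_coloring p D \<kappa>"
  shows "side_colors p (push ` D) (recolor \<kappa> m) (push (over_pt (3 / 2))) (dir (- 2) 3 (- 3)) m (\<kappa> (over_pt 0))"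
    and "side_colors p (push ` D) (recolor \<kappa> m) (push (over_pt (9 / 4))) (dir 4 (- 3) 3) (\<kappa> (over_pt 0)) m"
proof -
  have 1: "push (over_pt (3 / 2)) + s *\<^sub>R dir (- 2) 3 (- 3) = push (over_pt (3 / 2 + s))"
    "push (over_pt (3 / 2)) - s *\<^sub>R dir (- 2) 3 (- 3) = push (over_pt (3 / 2 - s))" if "0 < s" "s < 1 / 4" for s
    using push_over_pt_affine(1)[of s] push_over_pt_affine(1)[of "- s"] that by simp_all
  have 2: "push (over_pt (9 / 4)) + s *\<^sub>R dir 4 (- 3) 3 = push (over_pt (9 / 4 + s))"
    "push (over_pt (9 / 4)) - s *\<^sub>R dir 4 (- 3) 3 = push (over_pt (9 / 4 - s))" if "0 < s" "s < 1 / 4" for s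
    using push_over_pt_affine(2)[of s] push_over_pt_affine(2)[of "- s"] that by simp_all
  show "side_colors p (push ` D) (recolor \<kappa> m) (push (over_pt (3 / 2))) (dir (- 2) 3 (- 3)) m (\<kappa> (over_pt 0))"
    unfolding side_colors_def
  proof (intro exI[of _ "1 / 4"] conjI allI impI)
    fix s :: real assume "0 < s \<and> s < 1 / 4"
    then have s: "0 < s" "s < 1 / 4" by simp_all
    show "push (over_pt (3 / 2)) + s *\<^sub>R dir (- 2) 3 (- 3) \<in> over_points (push ` D)"
      unfolding 1[OF s] by (rule push_over_pt_over_point) (use s in auto)
    show "push (over_pt (3 / 2)) - s *\<^sub>R dir (- 2) 3 (- 3) \<in> over_points (push ` D)"
      unfolding 1[OF s] by (rule push_over_pt_over_point) (use s in auto)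
    show "[recolor \<kappa> m (push (over_pt (3 / 2)) + s *\<^sub>R dir (- 2) 3 (- 3)) = m] (mod int p)"
      unfolding 1[OF s] using s by simp
    show "[recolor \<kappa> m (push (over_pt (3 / 2)) - s *\<^sub>R dir (- 2) 3 (- 3)) = \<kappa> (over_pt 0)] (mod int p)"
      unfolding 1[OF s] using s color_over_pt[OF \<kappa>, of "3 / 2 - s"] by simp
  qed simp
  show "side_colors p (push ` D) (recolor \<kappa> m) (push (over_pt (9 / 4))) (dir 4 (- 3) 3) (\<kappa> (over_pt 0)) m"
    unfolding side_colors_def
  proof (intro exI[of _ "1 / 4"] conjI allI impI)
    fix s :: real assume "0 < s \<and> s < 1 / 4"
    then have s: "0 < s" "s < 1 / 4" by simp_all
    show "push (over_pt (9 / 4)) + s *\<^sub>R dir 4 (- 3) 3 \<in> over_points (push ` D)"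
      unfolding 2[OF s] by (rule push_over_pt_over_point) (use s in auto)
    show "push (over_pt (9 / 4)) - s *\<^sub>R dir 4 (- 3) 3 \<in> over_points (push ` D)"
      unfolding 2[OF s] by (rule push_over_pt_over_point) (use s in auto)
    show "[recolor \<kappa> m (push (over_pt (9 / 4)) + s *\<^sub>R dir 4 (- 3) 3) = \<kappa> (over_pt 0)] (mod int p)"
      unfolding 2[OF s] using s color_over_pt[OF \<kappa>, of "9 / 4 + s"] by simp
    show "[recolor \<kappa> m (push (over_pt (9 / 4)) - s *\<^sub>R dir 4 (- 3) 3) = m] (mod int p)"
      unfolding 2[OF s] using s by simp
  qed simp
qed

lemma side_colors_cong:
  assumes "side_colors p D' \<kappa> q w a c" "[a = a'] (mod int p)" "[c = c'] (mod int p)"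
  shows "side_colors p D' \<kappa> q w a' c'"
  using assms unfolding side_colors_def by (meson cong_trans)

text \<open>Old crossings keep their neighborhoods and colors. At both new crossings the over-strand is the
  positive half of the lower strand, and the under-strand passes between the color of the upper strand and
  the color \<open>m\<close> of the tip.\<close>

lemma point_coloring_push:
  assumes \<kappa>: "point_coloring p D \<kappa>"
    and m: "m \<in> {0..<int p}" "[m = 2 * \<kappa> (under_pt 1) - \<kappa> (over_pt 0)] (mod int p)"
  shows "point_coloring p (push ` D) (recolor \<kappa> m)"
  unfolding point_coloring_def
proof (intro conjI allI impI)
  let ?R = "over_points D - {over_pt (3 / 2), over_pt (9 / 4)}"
  show "recolor \<kappa> m ` over_points (push ` D) \<subseteq> {0..<int p}"
  proof
    fix z assume "z \<in> recolor \<kappa> m ` over_points (push ` D)"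
    then obtain q where q: "q \<in> ?R" "z = recolor \<kappa> m (push q)"
      unfolding over_points_push by blast
    have "\<kappa> q \<in> {0..<int p}" using \<kappa> q(1) unfolding point_coloring_def by blast
    then show "z \<in> {0..<int p}" using m(1) q(2) by simp
  qed
  show "recolor \<kappa> m constant_on S" if S: "connected S \<and> S \<subseteq> over_points (push ` D)" for S
  proof -
    obtain k where k: "homeomorphism UNIV UNIV push k" using push_homeomorphism by blast
    have kp: "k (push p) = p" "push (k p) = p" for p
      using homeomorphism_apply1[OF k] homeomorphism_apply2[OF k] by simp_all
    have "connected (k ` S)"
      using S homeomorphism_cont2[OF k]
      by (intro connected_continuous_image) (auto intro: continuous_on_subset)
    moreover have kS: "k ` S \<subseteq> ?R"
      using S kp(1) unfolding over_points_push by fastforce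
    ultimately have "\<kappa> constant_on k ` S" "k ` S \<subseteq> middle \<or> k ` S \<inter> middle = {}"
      using \<kappa> middle_clopen[of "k ` S"] unfolding point_coloring_def by blast+
    then obtain c where c: "\<forall>q\<in>k ` S. \<kappa> q = c" and cases: "k ` S \<subseteq> middle \<or> k ` S \<inter> middle = {}"
      unfolding constant_on_def by blast
    have rc: "recolor \<kappa> m x = (if k x \<in> middle then m else \<kappa> (k x))" for x
      using recolor_push[of \<kappa> m "k x"] kp(2) by simp
    show ?thesis
      using cases
    proof
      assume "k ` S \<subseteq> middle"
      then have "\<forall>x\<in>S. recolor \<kappa> m x = m" unfolding rc by auto
      then show ?thesis unfolding constant_on_def by blast
    next
      assume "k ` S \<inter> middle = {}"
      then have "\<forall>x\<in>S. recolor \<kappa> m x = c" unfolding rc using c by auto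
      then show ?thesis unfolding constant_on_def by blast
    qed
  qed
  fix x y assume xy: "undercrossing (push ` D) x y"
  then obtain q r where qr: "q \<in> D" "r \<in> D" "x = push q" "y = push r"
    unfolding undercrossing_def by blast
  have "undercrossing D q r \<or> new_pair q r"
    using xy undercrossing_push[OF qr(1,2)] qr(3,4) by simp
  then show "\<exists>w a. w \<noteq> 0 \<and> side_colors p (push ` D) (recolor \<kappa> m) x w a (2 * recolor \<kappa> m y - a)"
  proof
    assume u: "undercrossing D q r"
    then have un: "unmoved q" "unmoved r"
      using undercrossing_multiple unmoved_multiple by blast+
    obtain w a where wa: "w \<noteq> 0" "side_colors p D \<kappa> q w a (2 * \<kappa> r - a)"
      using \<kappa> u unfolding point_coloring_def by blast
    have "x = q" "y = r" using qr push_fixed unmovedD un by auto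
    moreover have "recolor \<kappa> m r = \<kappa> r" using recolor_unmoved(4)[OF unmovedD[OF un(2)]] .
    ultimately have "side_colors p (push ` D) (recolor \<kappa> m) x w a (2 * recolor \<kappa> m y - a)"
      using side_colors_unmoved[OF wa(2) un(1), of m] by simp
    then show ?thesis using wa(1) by blast
  next
    assume "new_pair q r"
    then have q: "q = over_pt (3 / 2) \<or> q = over_pt (9 / 4)" and "r = under_pt (3 / 2) \<or> r = under_pt (9 / 4)"
      unfolding new_pair_def by blast+
    then obtain y0 where y0: "0 < y0" "y0 < 10" "r = under_pt y0"
      using that[of "3 / 2"] that[of "9 / 4"] by auto
    have rc: "recolor \<kappa> m y = \<kappa> (under_pt 1)"
      using qr(4) y0 color_under_pt[OF \<kappa> y0(1,2)] recolor_push[of \<kappa> m "under_pt y0"] by simp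
    have c1: "[\<kappa> (over_pt 0) = 2 * recolor \<kappa> m y - m] (mod int p)"
      using m(2) unfolding rc by (smt (verit) cong_iff_dvd_diff dvd_minus_iff)
    have c2: "[m = 2 * recolor \<kappa> m y - \<kappa> (over_pt 0)] (mod int p)"
      using m(2) unfolding rc .
    have nz: "dir (- 2) 3 (- 3) \<noteq> 0" "dir 4 (- 3) 3 \<noteq> 0"
      by (rule dir_nonzero; simp)+
    show ?thesis
      using q
    proof
      assume "q = over_pt (3 / 2)"
      then have "side_colors p (push ` D) (recolor \<kappa> m) x (dir (- 2) 3 (- 3)) m (2 * recolor \<kappa> m y - m)"
        using side_colors_cong[OF side_colors_new(1)[OF \<kappa>] cong_refl c1] qr(3) by simp
      then show ?thesis using nz by blast
    next
      assume "q = over_pt (9 / 4)"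
      then have "side_colors p (push ` D) (recolor \<kappa> m) x (dir 4 (- 3) 3) (\<kappa> (over_pt 0)) (2 * recolor \<kappa> m y - \<kappa> (over_pt 0))"
        using side_colors_cong[OF side_colors_new(2)[OF \<kappa>] cong_refl c2] qr(3) by simp
      then show ?thesis using nz by blast
    qed
  qed
qed

text \<open>The diagram does not lose the color of the middle part, as the rest of the upper strand keeps it.\<close>

lemma recolor_image:
  assumes \<kappa>: "point_coloring p D \<kappa>"
  shows "\<kappa> ` over_points D \<subseteq> recolor \<kappa> m ` over_points (push ` D)"
proof
  fix c assume "c \<in> \<kappa> ` over_points D"
  then obtain q where q: "q \<in> over_points D" "c = \<kappa> q" by blast
  show "c \<in> recolor \<kappa> m ` over_points (push ` D)"
  proof (cases "q \<in> middle \<union> {over_pt (3 / 2), over_pt (9 / 4)}")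
    case True
    then have "q \<in> over_pt ` {3 / 2..9 / 4}" unfolding middle_def by (auto intro!: imageI)
    then obtain x where "q = over_pt x" "x \<in> {3 / 2..9 / 4}" by (rule imageE)
    then have x: "q = over_pt x" "\<bar>x\<bar> < 10" by simp_all
    have "c = recolor \<kappa> m (push (over_pt 0))" using color_over_pt[OF \<kappa> x(2)] x(1) q(2) by simp
    moreover have "push (over_pt 0) \<in> over_points (push ` D)" by (rule push_over_pt_over_point) simp_all
    ultimately show ?thesis by blast
  next
    case False
    then have "c = recolor \<kappa> m (push q)" "push q \<in> over_points (push ` D)"
      using q unfolding over_points_push by auto
    then show ?thesis by blast
  qed
qed

end

text \<open>One finger move. Of the two new crossings the one closer to the original crossing is passed on; its
  under-strand is reversed such that the tip, with the new color, lies behind.\<close>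

lemma coloring_step:
  assumes D: "diagram_of D L" and \<kappa>: "point_coloring p D \<kappa>" and p: "0 < p"
    and uv: "undercrossing D u v" and w: "w \<noteq> 0"
    and sc: "side_colors p D \<kappa> u w a (2 * b - a)" and vb: "[\<kappa> v = b] (mod int p)"
  obtains D' \<kappa>' u' v' w' where "diagram_of D' L" "point_coloring p D' \<kappa>'"
    "\<kappa> ` over_points D \<subseteq> \<kappa>' ` over_points D'" "undercrossing D' u' v'" "w' \<noteq> 0"
    "side_colors p D' \<kappa>' u' w' b (2 * (2 * b - a) - b)" "[\<kappa>' v' = 2 * b - a] (mod int p)"
proof -
  have link: "polygonal_link D" and reg: "regular_projection D" and iso: "ambient_isotopic D L"
    using D unfolding diagram_of_def by auto
  obtain e where e: "0 < e" "\<And>s. 0 < s \<Longrightarrow> s < e \<Longrightarrow>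
      u + s *\<^sub>R w \<in> over_points D \<and> [\<kappa> (u - s *\<^sub>R w) = 2 * b - a] (mod int p)"
    using sc unfolding side_colors_def by blast
  obtain r d_over d_under \<eta> X Y Z where r: "0 < r" and d_under: "d_under = - r *\<^sub>R w" and \<eta>: "\<eta> = v - u"
    and chart: "crossing_chart u d_over d_under \<eta> X Y Z D"
    by (rule crossing_chart_exists[OF link reg uv w e(1)]) (use e(2) in auto)
  interpret crossing_chart u d_over d_under \<eta> X Y Z D by (rule chart)
  have A0: "over_pt 0 = v" unfolding over_pt_def pt_def dir_def using \<eta> by simp
  have Wy: "under_pt y = u - (y * r) *\<^sub>R w" for y
    unfolding under_pt_def pt_def dir_def using d_under by simp
  define s where "s = min (e / 2) (r / 2)"
  have s: "0 < s" "s < e" "s / r < 10" unfolding s_def using e(1) r by (auto simp: min_def field_simps)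
  \<comment> \<open>The side of color \<open>2 * b - a\<close> is the positive half of the lower strand, of which \<open>under_pt 1\<close> is a
    typical point.\<close>
  have "\<kappa> (u - s *\<^sub>R w) = \<kappa> (under_pt 1)"
    using color_under_pt[OF \<kappa>, of "s / r"] s r Wy[of "s / r"] by simp
  then have W1: "[\<kappa> (under_pt 1) = 2 * b - a] (mod int p)" using e(2)[OF s(1,2)] by simp
  define m where "m = (2 * \<kappa> (under_pt 1) - \<kappa> (over_pt 0)) mod int p"
  have m: "m \<in> {0..<int p}" "[m = 2 * \<kappa> (under_pt 1) - \<kappa> (over_pt 0)] (mod int p)"
    unfolding m_def using p by (auto simp: cong_def)
  have A0b: "[\<kappa> (over_pt 0) = b] (mod int p)" using vb A0 by simp
  have mb: "[m = 2 * (2 * b - a) - b] (mod int p)"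
    using cong_trans[OF m(2) cong_diff[OF cong_scalar_left[OF W1] A0b]] .
  show thesis
  proof (rule that)
    show "diagram_of (push ` D) L"
      unfolding diagram_of_def
      using polygonal_link_image[OF link piecewise_affine_push inj_push continuous_push]
        regular_projection_push[OF reg] ambient_isotopic_trans[OF ambient_isotopic_sym[OF ambient_isotopic_push] iso]
      by blast
    show "point_coloring p (push ` D) (recolor \<kappa> m)"
      by (rule point_coloring_push[OF \<kappa> m])
    show "\<kappa> ` over_points D \<subseteq> recolor \<kappa> m ` over_points (push ` D)"
      by (rule recolor_image[OF \<kappa>])
    show "undercrossing (push ` D) (push (over_pt (3 / 2))) (push (under_pt (3 / 2)))"
      using undercrossing_push[of "over_pt (3 / 2)" "under_pt (3 / 2)"] over_pt_in_D under_pt_in_D unfolding new_pair_def by simp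
    show "- dir (- 2) 3 (- 3) \<noteq> 0" using dir_nonzero[of "- 2" 3 "- 3"] by simp
    show "side_colors p (push ` D) (recolor \<kappa> m) (push (over_pt (3 / 2))) (- dir (- 2) 3 (- 3)) b (2 * (2 * b - a) - b)"
      by (rule side_colors_cong[OF side_colors_uminus[OF side_colors_new(1)[OF \<kappa>]] A0b mb])
    show "[recolor \<kappa> m (push (under_pt (3 / 2))) = 2 * b - a] (mod int p)"
      using W1 color_under_pt[OF \<kappa>, of "3 / 2"] recolor_push[of \<kappa> m "under_pt (3 / 2)"] by simp
  qed
qed


section \<open>All colors from one crossing\<close>

text \<open>The colors \<open>a + n * (b - a)\<close> and \<open>a + (n + 1) * (b - a)\<close> play the roles of \<open>a\<close> and \<open>b\<close> after \<open>n\<close>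
  finger moves.\<close>

lemma coloring_progression:
  assumes D: "diagram_of D L" and \<kappa>: "point_coloring p D \<kappa>" and p: "0 < p"
    and uv: "undercrossing D u v" and w: "w \<noteq> 0"
    and sc: "side_colors p D \<kappa> u w a (2 * b - a)" and vb: "[\<kappa> v = b] (mod int p)"
  shows "\<exists>D' \<kappa>' u' v' w'. diagram_of D' L \<and> point_coloring p D' \<kappa>' \<and>
    (\<forall>j\<le>n. \<exists>x\<in>over_points D'. [\<kappa>' x = a + int j * (b - a)] (mod int p)) \<and>
    undercrossing D' u' v' \<and> w' \<noteq> 0 \<and>
    side_colors p D' \<kappa>' u' w' (a + int n * (b - a)) (2 * (a + int (Suc n) * (b - a)) - (a + int n * (b - a))) \<and>
    [\<kappa>' v' = a + int (Suc n) * (b - a)] (mod int p)"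
proof (induction n)
  have side: "\<exists>x\<in>over_points D. [\<kappa> x = a] (mod int p)" if side: "side_colors p D \<kappa> u w a c"
    for D \<kappa> u w a c
  proof -
    obtain e where e: "0 < e" "\<forall>s. 0 < s \<and> s < e \<longrightarrow>
        u + s *\<^sub>R w \<in> over_points D \<and> u - s *\<^sub>R w \<in> over_points D \<and>
        [\<kappa> (u + s *\<^sub>R w) = a] (mod int p) \<and> [\<kappa> (u - s *\<^sub>R w) = c] (mod int p)"
      using side unfolding side_colors_def by blast
    then have "u + (e / 2) *\<^sub>R w \<in> over_points D \<and> [\<kappa> (u + (e / 2) *\<^sub>R w) = a] (mod int p)" by simp
    then show ?thesis by blast
  qed
  {
    case 0
    show ?case
      using D \<kappa> uv w sc vb side[OF sc]
      by (intro exI[of _ D] exI[of _ \<kappa>] exI[of _ u] exI[of _ v] exI[of _ w]) simp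
  next
    case (Suc n)
    let ?a = "\<lambda>n. a + int n * (b - a)"
    obtain D1 \<kappa>1 u1 v1 w1 where IH: "diagram_of D1 L" "point_coloring p D1 \<kappa>1"
      "\<forall>j\<le>n. \<exists>x\<in>over_points D1. [\<kappa>1 x = ?a j] (mod int p)"
      "undercrossing D1 u1 v1" "w1 \<noteq> 0"
      "side_colors p D1 \<kappa>1 u1 w1 (?a n) (2 * ?a (Suc n) - ?a n)" "[\<kappa>1 v1 = ?a (Suc n)] (mod int p)"
      using Suc by blast
    obtain D2 \<kappa>2 u2 v2 w2 where S: "diagram_of D2 L" "point_coloring p D2 \<kappa>2"
      "\<kappa>1 ` over_points D1 \<subseteq> \<kappa>2 ` over_points D2" "undercrossing D2 u2 v2" "w2 \<noteq> 0"
      "side_colors p D2 \<kappa>2 u2 w2 (?a (Suc n)) (2 * (2 * ?a (Suc n) - ?a n) - ?a (Suc n))"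
      "[\<kappa>2 v2 = 2 * ?a (Suc n) - ?a n] (mod int p)"
      by (rule coloring_step[OF IH(1,2) p IH(4-7)])
    have next_a: "2 * ?a (Suc n) - ?a n = ?a (Suc (Suc n))" by (simp add: algebra_simps)
    have "\<exists>x\<in>over_points D2. [\<kappa>2 x = ?a j] (mod int p)" if j: "j \<le> Suc n" for j
    proof (cases "j = Suc n")
      case True
      then show ?thesis using side[OF S(6)] by simp
    next
      case False
      then have "j \<le> n" using j by simp
      then obtain x where x: "x \<in> over_points D1" "[\<kappa>1 x = ?a j] (mod int p)" using IH(3) by blast
      then obtain y where "y \<in> over_points D2" "\<kappa>2 y = \<kappa>1 x" using S(3) by (metis image_subset_iff imageE)
      then have "y \<in> over_points D2" "[\<kappa>2 y = ?a j] (mod int p)" using x(2) by simp_all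
      then show ?thesis by blast
    qed
    then show ?case
      using S(1,2,4-7) unfolding next_a by blast
  }
qed

text \<open>As \<open>b - a\<close> is a unit, the progression \<open>a + j * (b - a)\<close> meets every residue class within its first
  \<open>p\<close> terms, and no coloring has more than \<open>p\<close> colors.\<close>

lemma maxcol_eq_of_unit_crossing:
  assumes p: "1 < p" and D: "diagram_of D L" and c: "nontrivial_coloring p D c"
    and ABC: "crossing D A B C"
    and A: "[c A = b] (mod int p)" and B: "[c B = a] (mod int p)" and C: "[c C = 2 * b - a] (mod int p)"
    and k: "[(b - a) * k = 1] (mod int p)"
  shows "maxcol p L = p"
proof -
  have reg: "regular_projection D" using D unfolding diagram_of_def by blast
  have pc: "point_coloring p D (color_at D c)"
    using point_coloring_color_at[OF reg] c unfolding nontrivial_coloring_def by blast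
  obtain u v w where uvw: "undercrossing D u v" "w \<noteq> 0" "color_at D c v = c A"
    "side_colors p D (color_at D c) u w (c B) (c C)"
    by (rule crossing_side_colors[OF reg ABC])
  have sc: "side_colors p D (color_at D c) u w a (2 * b - a)"
    using uvw(4) B C unfolding side_colors_def by (meson cong_trans)
  have p0: "0 < p" using p by simp
  obtain D' \<kappa> where D': "diagram_of D' L" "point_coloring p D' \<kappa>"
    and prog: "\<forall>j\<le>p. \<exists>x\<in>over_points D'. [\<kappa> x = a + int j * (b - a)] (mod int p)"
    using coloring_progression[OF D pc p0 uvw(1,2) sc, of p] A uvw(3) by auto
  have "t \<in> \<kappa> ` over_points D'" if t: "t \<in> {0..<int p}" for t
  proof -
    \<comment> \<open>The solution of \<open>a + j * (b - a) = t\<close>, since \<open>k\<close> is the inverse of \<open>b - a\<close>.\<close>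
    define j where "j = nat ((k * (t - a)) mod int p)"
    have j: "int j = (k * (t - a)) mod int p" unfolding j_def using p by simp
    have "j \<le> p"
      using j pos_mod_bound[of "int p" "k * (t - a)"] p by linarith
    then obtain x where x: "x \<in> over_points D'" "[\<kappa> x = a + int j * (b - a)] (mod int p)"
      using prog by blast
    have "[int j * (b - a) = (k * (t - a)) * (b - a)] (mod int p)"
      unfolding j by (intro cong_scalar_right) (simp add: cong_def)
    also have "(k * (t - a)) * (b - a) = ((b - a) * k) * (t - a)" by (simp add: algebra_simps)
    also have "[((b - a) * k) * (t - a) = 1 * (t - a)] (mod int p)"
      by (rule cong_scalar_right[OF k])
    finally have "[a + int j * (b - a) = a + (t - a)] (mod int p)"
      by (intro cong_add cong_refl) simp
    then have "[\<kappa> x = t] (mod int p)" using cong_trans[OF x(2)] by simp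
    moreover have "\<kappa> x \<in> {0..<int p}" using D'(2) x(1) unfolding point_coloring_def by blast
    ultimately have "\<kappa> x = t" using t cong_less_imp_eq_int by auto
    then show ?thesis using x(1) by blast
  qed
  then have all: "\<kappa> ` over_points D' = {0..<int p}"
    using D'(2) unfolding point_coloring_def by blast
  have "regular_projection D'" using D'(1) unfolding diagram_of_def by blast
  then obtain c' where c': "coloring p D' c'" "c' ` arcs D' = \<kappa> ` over_points D'"
    using coloring_of_point_coloring D'(2) by blast
  then have num: "num_colors D' c' = p" unfolding num_colors_def all by simp
  then have "nontrivial_coloring p D' c'" using c'(1) p unfolding nontrivial_coloring_def by simp
  then have "p \<in> color_counts p L" using D'(1) num unfolding color_counts_def by blast
  then show ?thesis
    unfolding maxcol_def
    by (intro Max_eqI finite_color_counts) (use color_counts_subset[of p L] in \<open>auto dest: subsetD\<close>)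
qed

theorem corollary1p1:
  fixes p :: nat and L :: "space3 set"
  assumes "(prime p \<and> odd p) \<or> (p > 1 \<and> \<not> prime p)"
    and "classical_link L"
    and "\<not> split_link L"
    and "admits_nontrivial_colorings p L"
  shows "((\<exists>D c A B C. diagram_of D L \<and> nontrivial_coloring p D c \<and> num_colors D c = mincol p L \<and>
              crossing D A B C \<and>
              [c A = 1] (mod int p) \<and> [c B = 0] (mod int p) \<and> [c C = 2] (mod int p))
            \<longrightarrow> maxcol p L = p)
       \<and> ((\<exists>D c A B C a b. diagram_of D L \<and> nontrivial_coloring p D c \<and> num_colors D c = mincol p L \<and>
              crossing D A B C \<and>
              [c A = b] (mod int p) \<and> [c B = a] (mod int p) \<and> [c C = 2 * b - a] (mod int p) \<and>
              (\<exists>k. [(b - a) * k = 1] (mod int p)))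
            \<longrightarrow> maxcol p L = p)"
proof -
  have p: "1 < p"
    using assms(1) prime_gt_1_nat by blast
  show ?thesis
  proof (intro conjI impI; elim exE conjE)
    fix D c A B C
    assume "diagram_of D L" "nontrivial_coloring p D c" "crossing D A B C"
      "[c A = 1] (mod int p)" "[c B = 0] (mod int p)" "[c C = 2] (mod int p)"
    then show "maxcol p L = p"
      using maxcol_eq_of_unit_crossing[OF p, of D L c A B C 1 0 1] by simp
  next
    fix D c A B C a b k
    assume "diagram_of D L" "nontrivial_coloring p D c" "crossing D A B C"
      "[c A = b] (mod int p)" "[c B = a] (mod int p)" "[c C = 2 * b - a] (mod int p)"
      "[(b - a) * k = 1] (mod int p)"
    then show "maxcol p L = p"
      by (rule maxcol_eq_of_unit_crossing[OF p])
  qed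
qed

end
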